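(* Let $G$ be a finitely generated left-orderable group acting co-finitely, minimally and with general type on a simplicial tree $T$, with all vertex stabilizers finitely generated. Let $v$ be a vertex of $T$, let $\mathcal{P}=\{G_e: e\in\mathrm{link}_T(v)\}$, and let $H\in\mathcal{P}$. Assume that the vertex stabilizer $G_v$ is Hucha with respect to $H$ and that every group in $\mathcal{P}$ is Prieto. Then $G$ is Hucha with respect to the family consisting of all cyclic subgroups of $G$ and all subgroups of $G$ acting elliptically on $T$.
   Context: Actions on trees are without edge inversions. $G_v$, $G_e$ denote stabilizers of a vertex, an edge; $\mathrm{link}_T(v)$ is the set of edges adjacent to $v$. Co-finite: finitely many orbits of vertices and edges. Minimal: $T$ is the only $G$-invariant subtree. General type: $G$ fixes no vertex and no end of $T$ and the orbit of a vertex meets at least three ends (ends are classes of rays with infinite intersection; $G$ fixes an end if some ray $p$ has $gp\cap p$ infinite for all $g$). A subgroup acts elliptically if it fixes a vertex. A positive cone of a group $K$ is a subsemigroup $P$ with $K=P\sqcup P^{-1}\sqcup\{1\}$. For a finite generating set $X$ with word metric $d_X$, an $r$-path is a sequence $g_0,\dots,g_n$ with $d_X(g_i,g_{i+1})\le r$; a subset is coarsely connected if for some $r$ any two of its points are joined by an $r$-path inside it. $S$ $r$-disconnects $H_1,H_2$ if every $r$-path from $H_1$ to $H_2$ meets $S$, and $r$-disconnects $P$ if it $r$-disconnects $\{u\},\{v\}$ for some $u,v\in P$. A negative swamp of width $r$ for a subgroup $L$ is $S\subseteq P^{-1}$ that $r$-disconnects $P$ and $r$-disconnects $g_1L,g_2L$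 for some $g_1,g_2$. A finitely generated left-orderable group $K$ is Hucha with respect to a family $\mathcal{H}$ (resp. a subgroup $L$, meaning $\mathcal{H}=\{L\}$) if for some (equivalently any) finite generating set, for every positive cone $P$, every member of $\mathcal{H}$ and every $r>0$ there is a negative swamp of width $r$ for it. $K$ is Prieto if it is finitely generated, left-orderable and all its positive cones are coarsely connected. *)

theory Defs
  imports "HOL-Algebra.Algebra"
begin

definition fin_gen :: "('g, 'b) monoid_scheme \<Rightarrow> bool" where
  "fin_gen K \<longleftrightarrow> (\<exists>Sg. finite Sg \<and> Sg \<subseteq> carrier K \<and> generate K Sg = carrier K)"

definition gen_set :: "('g, 'b) monoid_scheme \<Rightarrow> 'g set \<Rightarrow> bool" where
  "gen_set K Sg \<longleftrightarrow> finite Sg \<and> Sg \<subseteq> carrier K \<and> generate K Sg = carrier K"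

definition left_orderable :: "('g, 'b) monoid_scheme \<Rightarrow> bool" where
  "left_orderable K \<longleftrightarrow> (\<exists>R :: 'g \<Rightarrow> 'g \<Rightarrow> bool.
      (\<forall>a\<in>carrier K. \<not> R a a) \<and>
      (\<forall>a\<in>carrier K. \<forall>b\<in>carrier K. \<forall>c\<in>carrier K. R a b \<longrightarrow> R b c \<longrightarrow> R a c) \<and>
      (\<forall>a\<in>carrier K. \<forall>b\<in>carrier K. a \<noteq> b \<longrightarrow> R a b \<or> R b a) \<and>
      (\<forall>g\<in>carrier K. \<forall>a\<in>carrier K. \<forall>b\<in>carrier K. R a b \<longrightarrow> R (g \<otimes>\<^bsub>K\<^esub> a) (g \<otimes>\<^bsub>K\<^esub> b)))"

definition positive_cone :: "('g, 'b) monoid_scheme \<Rightarrow> 'g set \<Rightarrow> bool" where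
  "positive_cone K P \<longleftrightarrow> P \<subseteq> carrier K \<and>
     (\<forall>a\<in>P. \<forall>b\<in>P. a \<otimes>\<^bsub>K\<^esub> b \<in> P) \<and>
     carrier K = P \<union> (m_inv K) ` P \<union> {\<one>\<^bsub>K\<^esub>} \<and>
     P \<inter> (m_inv K) ` P = {} \<and> \<one>\<^bsub>K\<^esub> \<notin> P \<and> \<one>\<^bsub>K\<^esub> \<notin> (m_inv K) ` P"

definition word_len :: "('g, 'b) monoid_scheme \<Rightarrow> 'g set \<Rightarrow> 'g \<Rightarrow> nat" where
  "word_len K Sg g = (LEAST n. \<exists>ws. length ws = n \<and> set ws \<subseteq> Sg \<union> (m_inv K) ` Sg \<and>
                                   foldr (\<otimes>\<^bsub>K\<^esub>) ws \<one>\<^bsub>K\<^esub> = g)"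

definition word_dist :: "('g, 'b) monoid_scheme \<Rightarrow> 'g set \<Rightarrow> 'g \<Rightarrow> 'g \<Rightarrow> nat" where
  "word_dist K Sg g h = word_len K Sg (inv\<^bsub>K\<^esub> g \<otimes>\<^bsub>K\<^esub> h)"

definition r_path :: "('g, 'b) monoid_scheme \<Rightarrow> 'g set \<Rightarrow> real \<Rightarrow> 'g list \<Rightarrow> bool" where
  "r_path K Sg r ps \<longleftrightarrow> ps \<noteq> [] \<and> set ps \<subseteq> carrier K \<and>
     (\<forall>i. Suc i < length ps \<longrightarrow> real (word_dist K Sg (ps ! i) (ps ! Suc i)) \<le> r)"

definition coarsely_connected :: "('g, 'b) monoid_scheme \<Rightarrow> 'g set \<Rightarrow> 'g set \<Rightarrow> bool" where
  "coarsely_connected K Sg A \<longleftrightarrow> (\<exists>r. \<forall>a\<in>A. \<forall>b\<in>A. \<exists>ps. r_path K Sg r ps \<and>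
       hd ps = a \<and> last ps = b \<and> set ps \<subseteq> A)"

definition r_disconnects :: "('g, 'b) monoid_scheme \<Rightarrow> 'g set \<Rightarrow> real \<Rightarrow> 'g set \<Rightarrow> 'g set \<Rightarrow> 'g set \<Rightarrow> bool" where
  "r_disconnects K Sg r S H1 H2 \<longleftrightarrow> (\<forall>ps. r_path K Sg r ps \<longrightarrow> hd ps \<in> H1 \<longrightarrow> last ps \<in> H2 \<longrightarrow>
       set ps \<inter> S \<noteq> {})"

definition r_disconnects_set :: "('g, 'b) monoid_scheme \<Rightarrow> 'g set \<Rightarrow> real \<Rightarrow> 'g set \<Rightarrow> 'g set \<Rightarrow> bool" where
  "r_disconnects_set K Sg r S P \<longleftrightarrow> (\<exists>u\<in>P. \<exists>v\<in>P. r_disconnects K Sg r S {u} {v})"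

definition negative_swamp :: "('g, 'b) monoid_scheme \<Rightarrow> 'g set \<Rightarrow> 'g set \<Rightarrow> 'g set \<Rightarrow> real \<Rightarrow> 'g set \<Rightarrow> bool" where
  "negative_swamp K Sg P L r S \<longleftrightarrow> S \<subseteq> (m_inv K) ` P \<and> r_disconnects_set K Sg r S P \<and>
     (\<exists>g1\<in>carrier K. \<exists>g2\<in>carrier K. r_disconnects K Sg r S (g1 <#\<^bsub>K\<^esub> L) (g2 <#\<^bsub>K\<^esub> L))"

definition Hucha :: "('g, 'b) monoid_scheme \<Rightarrow> 'g set set \<Rightarrow> bool" where
  "Hucha K \<H> \<longleftrightarrow> fin_gen K \<and> left_orderable K \<and>
     (\<exists>Sg. gen_set K Sg \<and> (\<forall>P. positive_cone K P \<longrightarrow> (\<forall>L\<in>\<H>. \<forall>r>0.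
         \<exists>S. negative_swamp K Sg P L r S)))"

definition Prieto :: "('g, 'b) monoid_scheme \<Rightarrow> bool" where
  "Prieto K \<longleftrightarrow> fin_gen K \<and> left_orderable K \<and>
     (\<exists>Sg. gen_set K Sg \<and> (\<forall>P. positive_cone K P \<longrightarrow> coarsely_connected K Sg P))"

definition walk :: "('v \<Rightarrow> 'v \<Rightarrow> bool) \<Rightarrow> 'v list \<Rightarrow> bool" where
  "walk Adj ws \<longleftrightarrow> ws \<noteq> [] \<and> (\<forall>i. Suc i < length ws \<longrightarrow> Adj (ws ! i) (ws ! Suc i))"

definition connected_in :: "('v \<Rightarrow> 'v \<Rightarrow> bool) \<Rightarrow> 'v set \<Rightarrow> bool" where
  "connected_in Adj S \<longleftrightarrow> (\<forall>u\<in>S. \<forall>w\<in>S. \<exists>ws. walk Adj ws \<and> set ws \<subseteq> S \<and> hd ws = u \<and> last ws = w)"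

definition is_tree :: "'v set \<Rightarrow> ('v \<Rightarrow> 'v \<Rightarrow> bool) \<Rightarrow> bool" where
  "is_tree V Adj \<longleftrightarrow> V \<noteq> {} \<and>
     (\<forall>u w. Adj u w \<longrightarrow> u \<in> V \<and> w \<in> V \<and> Adj w u \<and> u \<noteq> w) \<and>
     connected_in Adj V \<and>
     (\<forall>cs. length cs \<ge> 3 \<longrightarrow> distinct cs \<longrightarrow> walk Adj cs \<longrightarrow> \<not> Adj (last cs) (hd cs))"

definition edges :: "('v \<Rightarrow> 'v \<Rightarrow> bool) \<Rightarrow> 'v set set" where
  "edges Adj = {{u, w} | u w. Adj u w}"

definition link :: "('v \<Rightarrow> 'v \<Rightarrow> bool) \<Rightarrow> 'v \<Rightarrow> 'v set set" where
  "link Adj v = {e \<in> edges Adj. v \<in> e}"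

definition ray :: "'v set \<Rightarrow> ('v \<Rightarrow> 'v \<Rightarrow> bool) \<Rightarrow> (nat \<Rightarrow> 'v) \<Rightarrow> bool" where
  "ray V Adj p \<longleftrightarrow> inj p \<and> (\<forall>i. p i \<in> V \<and> Adj (p i) (p (Suc i)))"

definition same_end :: "(nat \<Rightarrow> 'v) \<Rightarrow> (nat \<Rightarrow> 'v) \<Rightarrow> bool" where
  "same_end p q \<longleftrightarrow> infinite (range p \<inter> range q)"

definition tree_action :: "('g, 'b) monoid_scheme \<Rightarrow> 'v set \<Rightarrow> ('v \<Rightarrow> 'v \<Rightarrow> bool) \<Rightarrow> ('g \<Rightarrow> 'v \<Rightarrow> 'v) \<Rightarrow> bool" where
  "tree_action G V Adj \<phi> \<longleftrightarrow> group G \<and> is_tree V Adj \<and> group_action G V \<phi> \<and>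
     (\<forall>g\<in>carrier G. \<forall>u w. Adj u w \<longrightarrow> Adj (\<phi> g u) (\<phi> g w))"

definition without_inversions :: "('g, 'b) monoid_scheme \<Rightarrow> ('v \<Rightarrow> 'v \<Rightarrow> bool) \<Rightarrow> ('g \<Rightarrow> 'v \<Rightarrow> 'v) \<Rightarrow> bool" where
  "without_inversions G Adj \<phi> \<longleftrightarrow>
     \<not> (\<exists>g\<in>carrier G. \<exists>u w. Adj u w \<and> \<phi> g u = w \<and> \<phi> g w = u)"

definition vstab :: "('g, 'b) monoid_scheme \<Rightarrow> ('g \<Rightarrow> 'v \<Rightarrow> 'v) \<Rightarrow> 'v \<Rightarrow> 'g set" where
  "vstab G \<phi> x = {g \<in> carrier G. \<phi> g x = x}"

definition estab :: "('g, 'b) monoid_scheme \<Rightarrow> ('g \<Rightarrow> 'v \<Rightarrow> 'v) \<Rightarrow> 'v set \<Rightarrow> 'g set" where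
  "estab G \<phi> e = {g \<in> carrier G. \<phi> g ` e = e}"

definition cofinite_action :: "('g, 'b) monoid_scheme \<Rightarrow> 'v set \<Rightarrow> ('v \<Rightarrow> 'v \<Rightarrow> bool) \<Rightarrow> ('g \<Rightarrow> 'v \<Rightarrow> 'v) \<Rightarrow> bool" where
  "cofinite_action G V Adj \<phi> \<longleftrightarrow> finite {orbit G \<phi> x | x. x \<in> V} \<and>
     finite {{\<phi> g ` e | g. g \<in> carrier G} | e. e \<in> edges Adj}"

definition minimal_action :: "('g, 'b) monoid_scheme \<Rightarrow> 'v set \<Rightarrow> ('v \<Rightarrow> 'v \<Rightarrow> bool) \<Rightarrow> ('g \<Rightarrow> 'v \<Rightarrow> 'v) \<Rightarrow> bool" where
  "minimal_action G V Adj \<phi> \<longleftrightarrow> (\<forall>S. S \<subseteq> V \<longrightarrow> S \<noteq> {} \<longrightarrow> connected_in Adj S \<longrightarrow>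
       (\<forall>g\<in>carrier G. \<phi> g ` S \<subseteq> S) \<longrightarrow> S = V)"

definition fixes_end :: "('g, 'b) monoid_scheme \<Rightarrow> 'v set \<Rightarrow> ('v \<Rightarrow> 'v \<Rightarrow> bool) \<Rightarrow> ('g \<Rightarrow> 'v \<Rightarrow> 'v) \<Rightarrow> bool" where
  "fixes_end G V Adj \<phi> \<longleftrightarrow> (\<exists>p. ray V Adj p \<and> (\<forall>g\<in>carrier G. infinite (range (\<phi> g \<circ> p) \<inter> range p)))"

definition general_type :: "('g, 'b) monoid_scheme \<Rightarrow> 'v set \<Rightarrow> ('v \<Rightarrow> 'v \<Rightarrow> bool) \<Rightarrow> ('g \<Rightarrow> 'v \<Rightarrow> 'v) \<Rightarrow> bool" where
  "general_type G V Adj \<phi> \<longleftrightarrow>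
     \<not> (\<exists>x\<in>V. \<forall>g\<in>carrier G. \<phi> g x = x) \<and>
     \<not> fixes_end G V Adj \<phi> \<and>
     (\<exists>x\<in>V. \<exists>p q s. ray V Adj p \<and> ray V Adj q \<and> ray V Adj s \<and>
        \<not> same_end p q \<and> \<not> same_end p s \<and> \<not> same_end q s \<and>
        infinite (range p \<inter> orbit G \<phi> x) \<and> infinite (range q \<inter> orbit G \<phi> x) \<and>
        infinite (range s \<inter> orbit G \<phi> x))"

definition acts_elliptically :: "('g, 'b) monoid_scheme \<Rightarrow> 'v set \<Rightarrow> ('g \<Rightarrow> 'v \<Rightarrow> 'v) \<Rightarrow> 'g set \<Rightarrow> bool" where
  "acts_elliptically G V \<phi> L \<longleftrightarrow> (\<exists>x\<in>V. \<forall>h\<in>L. \<phi> h x = x)"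

end

(*
  If S is a negative swamp then so is P^-1, so the task is to find two left cosets of each L, and two
  elements of P, that no r-path of elements g >= 1 can join.  Remove an edge of T: an r-path that changes
  sides passes through one of finitely many sets H k, H the stabilizer of the edge.  If all the sets H k are
  bounded above, a translate of the edge has all these crossing points negative.  Otherwise some H d is cofinal
  in G.  Then an r-path of elements above d running through several branches at v is projected to the
  vertex group: near v its points are x k with x in G_v and k from a finite set, and a c in H with c d >= k for all these k makes
  x c nonnegative for the cone of G_v induced by d P d^-1.  Excursions into a branch are replaced by paths in a
  coset of an edge group, whose positive cones are coarsely connected.  Since G_v is Hucha with respect to
  H, two branches at v cannot be joined.  In both cases two half-trees are separated; every half-tree is unbounded
  in the order and contains a translate of the orbit of v under any cyclic or elliptic subgroup.
*)
theory Submission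
  imports Defs
begin

section \<open>Half-trees\<close>

text \<open>An element \<open>g\<close> is located in the tree at \<open>\<phi> g v\<close>; this
  turns statements about half-trees into statements about the group. Half-trees are flexible because
  any of them can be moved into any other: minimality and the absence of a fixed end give this. An
  orbit under \<open>L\<close> then only has to miss one half-tree: it is bounded, or has at most
  two ends if \<open>L\<close> is cyclic, against the three ends provided by general type. The
  obstacle is the cofinal case. The order is invariant on the left only, so replacing a point
  \<open>x k\<close> near the vertex group by \<open>x\<close> may destroy positivity. The factor
  \<open>c\<close> repairs this for all \<open>x\<close> at once:
  \<open>k \<sqsubseteq> c \<otimes> d\<close> gives \<open>x k \<sqsubseteq> x c d\<close>. Taking
  \<open>c\<close> in \<open>H\<close> keeps every left coset \<open>g H\<close> intact under right
  multiplication by \<open>c\<close>, and these cosets correspond to the branches at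
  \<open>v\<close> in one orbit. The cone is based at \<open>d\<close> and not at the identity
  because cofinality is known for \<open>H d\<close>. Coarse connectedness is used for the edge
  groups of all branches, as a path may make an excursion into any of them.\<close>

definition induced :: "('v \<Rightarrow> 'v \<Rightarrow> bool) \<Rightarrow> 'v set \<Rightarrow> ('v \<times> 'v) set" where
  "induced Adj S = {(x, y). x \<in> S \<and> y \<in> S \<and> Adj x y}"

lemma walk_successively: "walk Adj ws \<longleftrightarrow> ws \<noteq> [] \<and> successively Adj ws"
  by (auto simp: walk_def successively_conv_nth)

lemma walk_rtrancl:
  assumes "walk Adj ws" "set ws \<subseteq> S"
  shows "(hd ws, last ws) \<in> (induced Adj S)\<^sup>*"
  using assms
proof (induction ws)
  case (Cons x ws)
  show ?case
  proof (cases ws)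
    case (Cons y ys)
    then have "(x, y) \<in> induced Adj S" "(y, last ws) \<in> (induced Adj S)\<^sup>*"
      using Cons.prems Cons.IH by (auto simp: walk_successively induced_def)
    then show ?thesis using Cons by (simp add: converse_rtrancl_into_rtrancl)
  qed simp
qed (simp add: walk_def)

text \<open>Loop erasure: when the next vertex already lies on the simple walk, the walk is cut back
  to that vertex.\<close>

lemma rtrancl_distinct_walk:
  assumes "(x, y) \<in> (induced Adj S)\<^sup>*" "x \<in> S"
  shows "\<exists>ws. walk Adj ws \<and> distinct ws \<and> set ws \<subseteq> S \<and> hd ws = x \<and> last ws = y"
  using assms
proof (induction rule: rtrancl_induct)
  case base
  then show ?case by (intro exI[of _ "[x]"]) (auto simp: walk_def)
next
  case (step y z)
  then obtain ws where ws: "walk Adj ws" "distinct ws" "set ws \<subseteq> S" "hd ws = x" "last ws = y"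
    by blast
  have yz: "z \<in> S" "Adj y z" using step by (auto simp: induced_def)
  show ?case
  proof (cases "z \<in> set ws")
    case True
    then obtain us vs where u: "ws = us @ z # vs" by (meson split_list)
    have "walk Adj (us @ [z])" "distinct (us @ [z])" "set (us @ [z]) \<subseteq> S" "hd (us @ [z]) = x"
      using ws u by (auto simp: walk_successively successively_append_iff hd_append)
    then show ?thesis by (metis last_snoc)
  next
    case False
    have "walk Adj (ws @ [z])"
      using ws yz by (auto simp: walk_successively successively_append_iff)
    moreover have "distinct (ws @ [z])" "set (ws @ [z]) \<subseteq> S" "hd (ws @ [z]) = x" "last (ws @ [z]) = z"
      using ws yz False by (auto simp: walk_def)
    ultimately show ?thesis by blast
  qed
qed

lemma connected_in_iff:
  "connected_in Adj S \<longleftrightarrow> (\<forall>x\<in>S. \<forall>y\<in>S. (x, y) \<in> (induced Adj S)\<^sup>*)"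
  unfolding connected_in_def
  by (metis rtrancl_distinct_walk walk_rtrancl)

text \<open>Removing the vertex \<open>a\<close> instead of the edge is convenient for inductions.
  For adjacent \<open>a\<close>, \<open>b\<close> in a tree the result is the side of
  \<open>b\<close> after removal of the edge, so half-trees are indexed by oriented edges.\<close>

definition halftree :: "'v set \<Rightarrow> ('v \<Rightarrow> 'v \<Rightarrow> bool) \<Rightarrow> 'v \<Rightarrow> 'v \<Rightarrow> 'v set" where
  "halftree V Adj a b = {x. (b, x) \<in> (induced Adj (V - {a}))\<^sup>*}"

locale simplicial_tree =
  fixes V :: "'v set" and Adj :: "'v \<Rightarrow> 'v \<Rightarrow> bool"
  assumes is_tree: "is_tree V Adj"
begin

abbreviation B :: "'v \<Rightarrow> 'v \<Rightarrow> 'v set" where "B \<equiv> halftree V Adj"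

lemma adjD: "Adj x y \<Longrightarrow> x \<in> V \<and> y \<in> V \<and> Adj y x \<and> x \<noteq> y"
  using is_tree by (auto simp: is_tree_def)

lemma conn: "x \<in> V \<Longrightarrow> y \<in> V \<Longrightarrow> (x, y) \<in> (induced Adj V)\<^sup>*"
  using is_tree by (auto simp: is_tree_def connected_in_iff)

lemma no_cycle: "length cs \<ge> 3 \<Longrightarrow> distinct cs \<Longrightarrow> walk Adj cs \<Longrightarrow> \<not> Adj (last cs) (hd cs)"
  using is_tree by (auto simp: is_tree_def)

lemma sym_induced: "sym (induced Adj S)"
  using adjD by (auto simp: sym_def induced_def)

lemma root_in: "b \<in> B a b"
  by (simp add: halftree_def)

lemma halftree_step: "x \<in> B a b \<Longrightarrow> Adj x y \<Longrightarrow> x \<noteq> a \<Longrightarrow> y \<noteq> a \<Longrightarrow> y \<in> B a b"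
  unfolding halftree_def using adjD
  by (auto simp: induced_def intro: rtrancl_into_rtrancl)

lemma halftree_sub: "Adj a b \<Longrightarrow> B a b \<subseteq> V - {a}"
proof
  fix x assume "Adj a b" "x \<in> B a b"
  then have "(b, x) \<in> (induced Adj (V - {a}))\<^sup>*" by (simp add: halftree_def)
  then show "x \<in> V - {a}"
    using adjD[OF \<open>Adj a b\<close>] by (induction rule: rtrancl_induct) (auto simp: induced_def)
qed

text \<open>A step that leaves can only end at \<open>a\<close>. If it started at some
  \<open>x \<noteq> b\<close>, a simple walk from \<open>b\<close> to \<open>x\<close> avoiding
  \<open>a\<close>, closed up through \<open>a\<close>, would be a cycle.\<close>

lemma boundary:
  assumes "Adj a b" "x \<in> B a b" "Adj x y" "y \<notin> B a b"
  shows "x = b \<and> y = a"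
proof -
  have xa: "x \<noteq> a" "x \<in> V" using assms halftree_sub by auto
  then have y: "y = a" using halftree_step assms by blast
  have "x = b"
  proof (rule ccontr)
    assume nb: "x \<noteq> b"
    have "(b, x) \<in> (induced Adj (V - {a}))\<^sup>*" using assms by (simp add: halftree_def)
    then obtain ws where ws: "walk Adj ws" "distinct ws" "set ws \<subseteq> V - {a}" "hd ws = b" "last ws = x"
      using rtrancl_distinct_walk[of b x Adj "V - {a}"] adjD[OF assms(1)] by auto
    then obtain p q zs where pq: "ws = p # q # zs"
      using nb by (cases ws; cases "tl ws") (auto simp: walk_def)
    have "walk Adj (a # ws)" using ws assms pq by (auto simp: walk_successively)
    moreover have "distinct (a # ws)" using ws by auto
    moreover have "length (a # ws) \<ge> 3" using pq by simp
    ultimately have "\<not> Adj (last (a # ws)) (hd (a # ws))" using no_cycle by blast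
    then show False using ws pq assms y by simp
  qed
  with y show ?thesis by simp
qed

lemma halftree_connected:
  assumes "Adj a b" shows "connected_in Adj (B a b)"
proof -
  have "(b, x) \<in> (induced Adj (B a b))\<^sup>*" if "x \<in> B a b" for x
  proof -
    have "(b, x) \<in> (induced Adj (V - {a}))\<^sup>*" using that by (simp add: halftree_def)
    then have "x \<in> B a b \<and> (b, x) \<in> (induced Adj (B a b))\<^sup>*"
    proof (induction rule: rtrancl_induct)
      case (step y z)
      then have "z \<in> B a b" using halftree_step[of y a b z] by (auto simp: induced_def)
      then have "(y, z) \<in> induced Adj (B a b)" using step by (auto simp: induced_def)
      then show ?case using step \<open>z \<in> B a b\<close> by auto
    qed (simp add: root_in)
    then show ?thesis by simp
  qed
  then show ?thesis
    unfolding connected_in_iff by (meson rtrancl_trans sym_induced sym_rtrancl symD)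
qed

lemma halftree_cover:
  assumes "Adj a b" "x \<in> V" shows "x \<in> B a b \<or> x \<in> B b a"
proof -
  have "(a, x) \<in> (induced Adj V)\<^sup>*" using conn assms adjD by blast
  then show ?thesis
  proof (induction rule: rtrancl_induct)
    case base then show ?case by (simp add: root_in)
  next
    case (step y z)
    then have "Adj y z" by (simp add: induced_def)
    then show ?case using step boundary assms adjD root_in by metis
  qed
qed

lemma halftree_disjoint:
  assumes "Adj a b" shows "B a b \<inter> B b a = {}"
proof -
  have "x \<notin> B a b" if "x \<in> B b a" for x
  proof -
    have "(a, x) \<in> (induced Adj (V - {b}))\<^sup>*" using that by (simp add: halftree_def)
    then show ?thesis
    proof (induction rule: rtrancl_induct)
      case base then show ?case using halftree_sub assms by auto
    next
      case (step y z)
      then show ?case using boundary[OF assms, of z y] adjD by (auto simp: induced_def)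
    qed
  qed
  then show ?thesis by auto
qed

text \<open>A walk inside \<open>C\<close> that changes sides has to use the edge itself, by
  \<open>boundary\<close>, and so would visit both of its ends.\<close>

lemma connected_split:
  assumes "Adj a b" "connected_in Adj C" "C \<subseteq> V" "\<not> (a \<in> C \<and> b \<in> C)"
  shows "C \<subseteq> B a b \<or> C \<subseteq> B b a"
proof (rule ccontr)
  assume "\<not> ?thesis"
  then obtain x y where xy: "x \<in> C" "y \<in> C" "x \<notin> B a b" "y \<notin> B b a" by auto
  then have "(x, y) \<in> (induced Adj C)\<^sup>*" using assms by (auto simp: connected_in_iff)
  then have "y \<notin> B a b"
    using xy(3)
  proof (induction rule: rtrancl_induct)
    case (step u w)
    then show ?case using boundary[OF assms(1), of w u] assms(4) adjD by (auto simp: induced_def)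
  qed
  then show False using xy halftree_cover assms by blast
qed

text \<open>The oriented edge is recovered as the only edge that leaves the half-tree.\<close>

lemma halftree_eqD:
  assumes "Adj a b" "Adj c d" "B a b = B c d" shows "a = c \<and> b = d"
  using boundary[OF assms(1), of d c] root_in[of d c] halftree_sub[OF assms(2)] adjD[OF assms(2)] assms(3)
  by auto

text \<open>Since \<open>B u w'\<close> avoids \<open>u\<close>, it lies on one side of the edge
  \<open>u w\<close>. It is not the side of \<open>w\<close>: its root \<open>w'\<close> is adjacent
  to \<open>u\<close>, and within \<open>B u w\<close> only \<open>w\<close> is.\<close>

lemma siblings_disjoint:
  assumes "Adj u w" "Adj u w'" "w \<noteq> w'" shows "B u w \<inter> B u w' = {}"
proof -
  have "B u w' \<subseteq> B u w \<or> B u w' \<subseteq> B w u"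
    using connected_split[OF assms(1) halftree_connected[OF assms(2)]] halftree_sub[OF assms(2)] by blast
  moreover have "\<not> B u w' \<subseteq> B u w"
    using boundary[OF assms(1), of w' u] root_in[of w' u] halftree_sub[OF assms(1)] adjD[OF assms(2)] assms(3)
    by auto
  ultimately show ?thesis using halftree_disjoint[OF assms(1)] by blast
qed

lemma direction_exists:
  assumes "u \<in> V" "y \<in> V" "y \<noteq> u" shows "\<exists>w. Adj u w \<and> y \<in> B u w"
proof -
  have "(u, y) \<in> (induced Adj V)\<^sup>*" using conn assms by blast
  then have "y = u \<or> (\<exists>w. Adj u w \<and> y \<in> B u w)"
  proof (induction rule: rtrancl_induct)
    case (step y z)
    then have "Adj y z" by (simp add: induced_def)
    then show ?case using step halftree_step halftree_sub root_in by (metis DiffD2 insertI1 subsetD)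
  qed simp
  then show ?thesis using assms by blast
qed

lemma connected_direction:
  assumes "connected_in Adj C" "C \<subseteq> V - {u}" "C \<noteq> {}" "u \<in> V"
  shows "\<exists>w. Adj u w \<and> C \<subseteq> B u w"
proof -
  obtain y where y: "y \<in> C" using assms by blast
  then obtain w where w: "Adj u w" "y \<in> B u w" using direction_exists[of u y] assms by blast
  then have "C \<subseteq> B u w \<or> C \<subseteq> B w u" using connected_split[of u w C] assms by blast
  then show ?thesis using w y halftree_disjoint[OF w(1)] by blast
qed

lemma halftree_nested:
  assumes "Adj y z" "Adj z w" "w \<noteq> y" shows "B z w \<subseteq> B y z"
proof -
  have zy: "Adj z y" using adjD assms by blast
  have disj: "B z w \<inter> B z y = {}" using siblings_disjoint[OF assms(2) zy assms(3)] .
  then have "y \<notin> B z w" using root_in by blast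
  then have "B z w \<subseteq> B y z \<or> B z w \<subseteq> B z y"
    using connected_split[OF assms(1) halftree_connected[OF assms(2)]] halftree_sub[OF assms(2)] by blast
  then show ?thesis using disj root_in by blast
qed

section \<open>Edges separating two vertices, convexity of half-trees\<close>

text \<open>These are the edges of the geodesic from \<open>x\<close> to \<open>y\<close>, oriented
  towards \<open>y\<close>. Their number stands in for the distance, without any construction of
  geodesics.\<close>

definition sep :: "'v \<Rightarrow> 'v \<Rightarrow> ('v \<times> 'v) set" where
  "sep x y = {(a, b). Adj a b \<and> x \<notin> B a b \<and> y \<in> B a b}"

text \<open>By \<open>boundary\<close>, the last step of a walk from \<open>z\<close> to
  \<open>y\<close> can contribute no separating edge other than \<open>(z, y)\<close>.\<close>

lemma card_sep:
  assumes "(x, y) \<in> (induced Adj V) ^^ n"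
  shows "finite (sep x y) \<and> card (sep x y) \<le> n"
  using assms
proof (induction n arbitrary: y)
  case 0
  then have "sep x y = {}" by (auto simp: sep_def)
  then show ?case by simp
next
  case (Suc n)
  then obtain z where z: "(x, z) \<in> (induced Adj V) ^^ n" "(z, y) \<in> induced Adj V" by auto
  have "sep x y \<subseteq> insert (z, y) (sep x z)"
  proof
    fix e assume "e \<in> sep x y"
    then obtain a b where e: "e = (a, b)" "Adj a b" "x \<notin> B a b" "y \<in> B a b" by (auto simp: sep_def)
    then show "e \<in> insert (z, y) (sep x z)"
      using boundary[of a b y z] z(2) adjD by (auto simp: sep_def induced_def)
  qed
  moreover have "finite (sep x z)" "card (sep x z) \<le> n" using Suc.IH z by auto
  moreover have "card (insert (z, y) (sep x z)) \<le> Suc (card (sep x z))"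
    by (rule card_insert_le_m1) simp_all
  ultimately show ?case
    using card_mono[of "insert (z, y) (sep x z)" "sep x y"] finite_subset by fastforce
qed

lemma finite_sep: "x \<in> V \<Longrightarrow> y \<in> V \<Longrightarrow> finite (sep x y)"
  using card_sep conn by (meson rtrancl_imp_relpow)

text \<open>Convexity of half-trees: an exit and a later re-entry would both pass through
  \<open>b\<close>, which a simple walk visits only once.\<close>

lemma distinct_walk_stays:
  assumes "Adj a b" "walk Adj ws" "distinct ws" "hd ws \<in> B a b" "last ws \<in> B a b"
  shows "set ws \<subseteq> B a b"
proof (rule ccontr)
  assume "\<not> ?thesis"
  then obtain k where k: "k < length ws" "ws ! k \<notin> B a b" by (metis in_set_conv_nth subsetI)
  have ne: "ws \<noteq> []" using k by auto
  have step: "Adj (ws ! i) (ws ! Suc i)" if "Suc i < length ws" for i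
    using assms that by (auto simp: walk_def)
  have "\<exists>i<k. ws ! i \<in> B a b \<and> ws ! Suc i \<notin> B a b"
  proof (rule ccontr)
    assume *: "\<not> ?thesis"
    have "i \<le> k \<Longrightarrow> ws ! i \<in> B a b" for i
      by (induction i) (use assms(4) ne * in \<open>auto simp: hd_conv_nth\<close>)
    then show False using k by blast
  qed
  then obtain i where i: "i < k" "ws ! i \<in> B a b" "ws ! Suc i \<notin> B a b" by blast
  have "\<exists>j\<ge>k. Suc j < length ws \<and> ws ! j \<notin> B a b \<and> ws ! Suc j \<in> B a b"
  proof (rule ccontr)
    assume *: "\<not> ?thesis"
    have "k + j < length ws \<Longrightarrow> ws ! (k + j) \<notin> B a b" for j
      by (induction j) (use k * in auto)
    from this[of "length ws - 1 - k"] show False using assms(5) ne k by (auto simp: last_conv_nth)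
  qed
  then obtain j where j: "j \<ge> k" "Suc j < length ws" "ws ! j \<notin> B a b" "ws ! Suc j \<in> B a b" by blast
  have "ws ! i = b" using boundary[OF assms(1) i(2) step i(3)] i k by auto
  moreover have "ws ! Suc j = b" using boundary[OF assms(1) j(4) _ j(3)] step[OF j(2)] adjD by blast
  ultimately have "i = Suc j" using assms(3) i j k by (metis distinct_conv_nth less_trans)
  then show False using i j by simp
qed

text \<open>One simple walk between the two points stays in all the half-trees at the same time, by
  convexity. That \<open>I\<close> is not empty places the points in \<open>V\<close>.\<close>

lemma Inter_halftrees_connected:
  assumes "\<And>a b. (a, b) \<in> I \<Longrightarrow> Adj a b" "I \<noteq> {}"
  shows "connected_in Adj (\<Inter>(a, b)\<in>I. B a b)"
  unfolding connected_in_def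
proof (intro ballI)
  fix x y assume xy: "x \<in> (\<Inter>(a, b)\<in>I. B a b)" "y \<in> (\<Inter>(a, b)\<in>I. B a b)"
  have "x \<in> V" "y \<in> V" using xy assms halftree_sub by fastforce+
  then obtain ws where ws: "walk Adj ws" "distinct ws" "hd ws = x" "last ws = y"
    using rtrancl_distinct_walk[of x y Adj V] conn by metis
  have "set ws \<subseteq> B a b" if "(a, b) \<in> I" for a b
    using distinct_walk_stays[of a b ws] assms(1)[OF that] ws xy that by auto
  then have "set ws \<subseteq> (\<Inter>(a, b)\<in>I. B a b)" by blast
  then show "\<exists>ws. walk Adj ws \<and> set ws \<subseteq> (\<Inter>(a, b)\<in>I. B a b) \<and> hd ws = x \<and> last ws = y"
    using ws by blast
qed

section \<open>Rays and their nested half-trees\<close>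

lemma ray_halftree:
  assumes p: "ray V Adj p"
  shows "B (p (Suc n)) (p (Suc (Suc n))) \<subseteq> B (p n) (p (Suc n))"
  using halftree_nested p by (simp add: ray_def inj_eq)

lemma ray_halftree_antimono:
  assumes p: "ray V Adj p" and "n \<le> m"
  shows "B (p m) (p (Suc m)) \<subseteq> B (p n) (p (Suc n))"
  using lift_Suc_antimono_le[of "\<lambda>n. B (p n) (p (Suc n))", OF ray_halftree[OF p] assms(2)] .

text \<open>Nestedness keeps \<open>p 0\<close> outside all these half-trees, so each one that
  contains \<open>y\<close> yields a different element of the finite set
  \<open>sep (p 0) y\<close>.\<close>

lemma ray_leaves:
  assumes p: "ray V Adj p" and y: "y \<in> V"
  shows "finite {n. y \<in> B (p n) (p (Suc n))}"
proof -
  have adj: "Adj (p n) (p (Suc n))" for n using p by (simp add: ray_def)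
  have out: "p 0 \<notin> B (p n) (p (Suc n))" for n
  proof (cases n)
    case 0 then show ?thesis using halftree_sub[OF adj[of 0]] by auto
  next
    case (Suc m)
    then show ?thesis
      using ray_halftree_antimono[OF p, of 0 n] halftree_sub[OF adj[of 0]] by auto
  qed
  have "(\<lambda>n. (p n, p (Suc n))) ` {n. y \<in> B (p n) (p (Suc n))} \<subseteq> sep (p 0) y"
    using out adj by (auto simp: sep_def)
  moreover have "p 0 \<in> V" using p by (simp add: ray_def)
  ultimately have "finite ((\<lambda>n. (p n, p (Suc n))) ` {n. y \<in> B (p n) (p (Suc n))})"
    using finite_sep y finite_subset by blast
  moreover have "inj_on (\<lambda>n. (p n, p (Suc n))) A" for A
    using p by (auto simp: ray_def inj_on_def)
  ultimately show ?thesis using finite_imageD by blast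
qed

text \<open>If all these half-trees met, \<open>q\<close> would enter every
  \<open>B (p n) (p (Suc n))\<close>. Unless \<open>q\<close> starts inside, it enters across the
  boundary edge and passes through \<open>p n\<close>. As \<open>q 0\<close> is inside for finitely
  many \<open>n\<close> only, the rays would share infinitely many vertices.\<close>

lemma rays_disjoint_halftrees:
  assumes p: "ray V Adj p" and q: "ray V Adj q" and "\<not> same_end p q"
  shows "\<exists>n m. B (p n) (p (Suc n)) \<inter> B (q m) (q (Suc m)) = {}"
proof (rule ccontr)
  assume "\<not> ?thesis"
  then have meet: "B (p n) (p (Suc n)) \<inter> B (q m) (q (Suc m)) \<noteq> {}" for n m by blast
  have adjp: "Adj (p n) (p (Suc n))" for n using p by (simp add: ray_def)
  have adjq: "Adj (q n) (q (Suc n))" for n using q by (simp add: ray_def)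
  have enter: "\<exists>j. q j \<in> B (p n) (p (Suc n))" for n
  proof -
    have "finite {m. p n \<in> B (q m) (q (Suc m))}" using ray_leaves[OF q] adjp adjD by blast
    then obtain m where m: "p n \<notin> B (q m) (q (Suc m))"
      by (metis (mono_tags, lifting) ex_new_if_finite infinite_UNIV_nat mem_Collect_eq)
    have "B (q m) (q (Suc m)) \<subseteq> B (p n) (p (Suc n)) \<or> B (q m) (q (Suc m)) \<subseteq> B (p (Suc n)) (p n)"
      using connected_split[OF adjp halftree_connected[OF adjq]] m halftree_sub[OF adjq] by blast
    then have "B (q m) (q (Suc m)) \<subseteq> B (p n) (p (Suc n))"
      using meet[of n m] halftree_disjoint[OF adjp[of n]] by blast
    then show ?thesis using root_in by blast
  qed
  have hit: "p n \<in> range q" if out: "q 0 \<notin> B (p n) (p (Suc n))" for n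
  proof -
    obtain i where i: "q i \<notin> B (p n) (p (Suc n))" "q (Suc i) \<in> B (p n) (p (Suc n))"
    proof -
      obtain j where j: "q j \<in> B (p n) (p (Suc n))" using enter by blast
      define k where "k = (LEAST j. q j \<in> B (p n) (p (Suc n)))"
      have "q k \<in> B (p n) (p (Suc n))" unfolding k_def using j by (rule LeastI)
      moreover from this have "k \<noteq> 0" using out by metis
      moreover have "q (k - 1) \<notin> B (p n) (p (Suc n))"
        using \<open>k \<noteq> 0\<close> not_less_Least[of "k - 1" "\<lambda>j. q j \<in> B (p n) (p (Suc n))"]
        by (simp add: k_def)
      ultimately show thesis using that[of "k - 1"] by simp
    qed
    then have "q i = p n" using boundary[OF adjp i(2) _ i(1)] adjq adjD by blast
    then show ?thesis by (metis rangeI)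
  qed
  have "finite {n. q 0 \<in> B (p n) (p (Suc n))}" using ray_leaves[OF p] adjq adjD by blast
  then have "infinite (- {n. q 0 \<in> B (p n) (p (Suc n))})" by (simp add: Compl_eq_Diff_UNIV)
  then have "infinite (p ` (- {n. q 0 \<in> B (p n) (p (Suc n))}))"
    using finite_imageD inj_on_subset[OF _ subset_UNIV] p unfolding ray_def by blast
  moreover have "p ` (- {n. q 0 \<in> B (p n) (p (Suc n))}) \<subseteq> range p \<inter> range q"
    using hit by auto
  ultimately have "infinite (range p \<inter> range q)" using finite_subset by blast
  then show False using assms by (simp add: same_end_def)
qed

lemma three_halftrees:
  assumes "ray V Adj p" "ray V Adj q" "ray V Adj s"
    "\<not> same_end p q" "\<not> same_end p s" "\<not> same_end q s"
  shows "\<exists>a b c d e f. Adj a b \<and> Adj c d \<and> Adj e f \<and>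
    B a b \<inter> B c d = {} \<and> B a b \<inter> B e f = {} \<and> B c d \<inter> B e f = {}"
proof -
  obtain n1 m1 where d1: "B (p n1) (p (Suc n1)) \<inter> B (q m1) (q (Suc m1)) = {}"
    using rays_disjoint_halftrees[OF assms(1,2,4)] by blast
  obtain n2 m2 where d2: "B (p n2) (p (Suc n2)) \<inter> B (s m2) (s (Suc m2)) = {}"
    using rays_disjoint_halftrees[OF assms(1,3,5)] by blast
  obtain n3 m3 where d3: "B (q n3) (q (Suc n3)) \<inter> B (s m3) (s (Suc m3)) = {}"
    using rays_disjoint_halftrees[OF assms(2,3,6)] by blast
  define N where "N = Max {n1, m1, n2, m2, n3, m3}"
  have N: "n1 \<le> N" "m1 \<le> N" "n2 \<le> N" "m2 \<le> N" "n3 \<le> N" "m3 \<le> N" by (auto simp: N_def)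
  have "Adj (p N) (p (Suc N)) \<and> Adj (q N) (q (Suc N)) \<and> Adj (s N) (s (Suc N))"
    using assms by (simp add: ray_def)
  moreover have "B (p N) (p (Suc N)) \<inter> B (q N) (q (Suc N)) = {}"
    "B (p N) (p (Suc N)) \<inter> B (s N) (s (Suc N)) = {}"
    "B (q N) (q (Suc N)) \<inter> B (s N) (s (Suc N)) = {}"
    using d1 ray_halftree_antimono[OF assms(1) N(1)] ray_halftree_antimono[OF assms(2) N(2)]
    apply blast
    using d2 ray_halftree_antimono[OF assms(1) N(3)] ray_halftree_antimono[OF assms(3) N(4)]
    apply blast
    using d3 ray_halftree_antimono[OF assms(2) N(5)] ray_halftree_antimono[OF assms(3) N(6)]
    by blast+
  ultimately show ?thesis by blast
qed

end

section \<open>Group actions on trees\<close>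

locale tree_acting_group = group G + group_action G V \<phi> + simplicial_tree V Adj
  for G :: "('g, 'b) monoid_scheme" (structure) and V :: "'v set" and Adj :: "'v \<Rightarrow> 'v \<Rightarrow> bool"
    and \<phi> :: "'g \<Rightarrow> 'v \<Rightarrow> 'v" +
  assumes adj_act: "g \<in> carrier G \<Longrightarrow> Adj x y \<Longrightarrow> Adj (\<phi> g x) (\<phi> g y)"
    and no_inversions: "without_inversions G Adj \<phi>"
begin

lemma act_mult: "g \<in> carrier G \<Longrightarrow> h \<in> carrier G \<Longrightarrow> x \<in> V \<Longrightarrow> \<phi> (g \<otimes> h) x = \<phi> g (\<phi> h x)"
  by (rule composition_rule)

lemma act_one: "x \<in> V \<Longrightarrow> \<phi> \<one> x = x"
  by (metis id_eq_one restrict_apply')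

lemma act_closed: "g \<in> carrier G \<Longrightarrow> x \<in> V \<Longrightarrow> \<phi> g x \<in> V"
  by (rule element_image) auto

lemma act_inv1: "g \<in> carrier G \<Longrightarrow> x \<in> V \<Longrightarrow> \<phi> (inv g) (\<phi> g x) = x"
  using act_mult[of "inv g" g x] by (simp add: act_one)

lemma act_inv2: "g \<in> carrier G \<Longrightarrow> x \<in> V \<Longrightarrow> \<phi> g (\<phi> (inv g) x) = x"
  using act_mult[of g "inv g" x] by (simp add: act_one)

lemma act_inj: "g \<in> carrier G \<Longrightarrow> x \<in> V \<Longrightarrow> y \<in> V \<Longrightarrow> \<phi> g x = \<phi> g y \<Longrightarrow> x = y"
  by (metis act_inv1)

lemma adj_V: "Adj x y \<Longrightarrow> x \<in> V" "Adj x y \<Longrightarrow> y \<in> V" "Adj x y \<Longrightarrow> Adj y x"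
  using adjD by auto

lemma no_flip: "g \<in> carrier G \<Longrightarrow> Adj x y \<Longrightarrow> \<not> (\<phi> g x = y \<and> \<phi> g y = x)"
  using no_inversions by (auto simp: without_inversions_def)

lemma halftree_act:
  assumes "g \<in> carrier G" "Adj a b" "x \<in> B a b"
  shows "\<phi> g x \<in> B (\<phi> g a) (\<phi> g b)"
proof -
  have "(b, x) \<in> (induced Adj (V - {a}))\<^sup>*" using assms by (simp add: halftree_def)
  then show ?thesis
  proof (induction rule: rtrancl_induct)
    case base then show ?case by (rule root_in)
  next
    case (step y z)
    then have yz: "y \<in> V" "z \<in> V" "y \<noteq> a" "z \<noteq> a" "Adj y z" by (auto simp: induced_def)
    then have "\<phi> g y \<noteq> \<phi> g a" "\<phi> g z \<noteq> \<phi> g a"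
      using act_inj[OF assms(1)] adj_V(1)[OF assms(2)] by metis+
    then show ?case using halftree_step[OF step.IH adj_act[OF assms(1) yz(5)]] by blast
  qed
qed

lemma halftree_act_iff:
  assumes "g \<in> carrier G" "Adj a b" "x \<in> V"
  shows "\<phi> g x \<in> B (\<phi> g a) (\<phi> g b) \<longleftrightarrow> x \<in> B a b"
proof
  assume "\<phi> g x \<in> B (\<phi> g a) (\<phi> g b)"
  from halftree_act[OF _ adj_act[OF assms(1,2)] this, of "inv g"]
  show "x \<in> B a b" using assms adj_V(1,2)[OF assms(2)] by (simp add: act_inv1)
qed (use assms halftree_act in blast)

lemma halftree_act_image:
  assumes "g \<in> carrier G" "Adj a b"
  shows "\<phi> g ` B a b = B (\<phi> g a) (\<phi> g b)"
proof
  show "\<phi> g ` B a b \<subseteq> B (\<phi> g a) (\<phi> g b)" using halftree_act assms by blast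
  show "B (\<phi> g a) (\<phi> g b) \<subseteq> \<phi> g ` B a b"
  proof
    fix y assume y: "y \<in> B (\<phi> g a) (\<phi> g b)"
    then have "y \<in> V" using halftree_sub adj_act assms by blast
    then have "\<phi> (inv g) y \<in> B a b"
      using halftree_act_iff[OF assms, of "\<phi> (inv g) y"] y assms act_closed by (simp add: act_inv2)
    then show "y \<in> \<phi> g ` B a b" using act_inv2[OF assms(1) \<open>y \<in> V\<close>] by (metis image_eqI)
  qed
qed

lemma sep_act:
  assumes "g \<in> carrier G" "x \<in> V" "y \<in> V" "(a, b) \<in> sep (\<phi> g x) (\<phi> g y)"
  shows "(\<phi> (inv g) a, \<phi> (inv g) b) \<in> sep x y"
proof -
  have ab: "Adj a b" "\<phi> g x \<notin> B a b" "\<phi> g y \<in> B a b" using assms by (auto simp: sep_def)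
  have i: "inv g \<in> carrier G" using assms by simp
  show ?thesis
    using adj_act[OF i ab(1)] ab assms act_closed
      halftree_act_iff[OF i ab(1), of "\<phi> g x"] halftree_act_iff[OF i ab(1), of "\<phi> g y"]
    by (simp add: sep_def act_inv1)
qed

section \<open>Moving half-trees by the group\<close>

text \<open>Otherwise the intersection of all translates would be a non-empty invariant subtree that
  misses \<open>a\<close>.\<close>

lemma minimal_halftrees:
  assumes min: "minimal_action G V Adj \<phi>" and ab: "Adj a b" and y: "y \<in> V"
  shows "\<exists>g\<in>carrier G. y \<notin> B (\<phi> g a) (\<phi> g b)"
proof (rule ccontr)
  assume contra: "\<not> ?thesis"
  define I where "I = {(\<phi> g a, \<phi> g b) | g. g \<in> carrier G}"
  define M where "M = (\<Inter>(a, b)\<in>I. B a b)"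
  have I: "Adj c d" if "(c, d) \<in> I" for c d using that ab adj_act by (auto simp: I_def)
  have ne: "I \<noteq> {}" using one_closed by (auto simp: I_def)
  have "(\<phi> \<one> a, \<phi> \<one> b) \<in> I" unfolding I_def using one_closed by blast
  then have "(a, b) \<in> I" using ab adj_V by (simp add: act_one)
  then have M1: "M \<subseteq> B a b" by (auto simp: M_def)
  have "connected_in Adj M" unfolding M_def by (rule Inter_halftrees_connected[OF I ne])
  moreover have "y \<in> M" using contra by (auto simp: M_def I_def)
  moreover have M_V: "M \<subseteq> V" using M1 halftree_sub[OF ab] by blast
  moreover have "\<phi> g ` M \<subseteq> M" if g: "g \<in> carrier G" for g
  proof
    fix z assume "z \<in> \<phi> g ` M"
    then obtain x where x: "x \<in> M" "z = \<phi> g x" by blast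
    have "z \<in> B (\<phi> h a) (\<phi> h b)" if h: "h \<in> carrier G" for h
    proof -
      have k: "inv g \<otimes> h \<in> carrier G" using g h by simp
      then have "x \<in> B (\<phi> (inv g \<otimes> h) a) (\<phi> (inv g \<otimes> h) b)"
        using x by (auto simp: M_def I_def)
      from halftree_act[OF g adj_act[OF k ab] this] show ?thesis
        using x g h adj_V(1,2)[OF ab] act_closed by (simp add: act_mult act_inv2)
    qed
    then show "z \<in> M" by (auto simp: M_def I_def)
  qed
  ultimately have "M = V" using min unfolding minimal_action_def by (metis empty_iff)
  moreover have "a \<notin> M"
    using halftree_sub[OF ab] M1 by blast
  ultimately show False using ab adj_V by blast
qed

text \<open>If no translate of the half-tree \<open>Y = B c d\<close> lies in \<open>B a b\<close>, the translates of \<open>Y\<close> and of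
  the complement \<open>Z = B b a\<close> all intersect each other.  From every vertex \<open>y\<close> they then
  lie in one common direction \<open>\<pi> y\<close> (as far as they avoid \<open>y\<close>), and following \<open>\<pi>\<close> leads to a fixed end.\<close>

lemma halftree_skewer:
  assumes min: "minimal_action G V Adj \<phi>" and nend: "\<not> fixes_end G V Adj \<phi>"
    and ab: "Adj a b" and cd: "Adj c d"
  shows "\<exists>g\<in>carrier G. \<phi> g ` B c d \<subseteq> B a b"
proof (rule ccontr)
  assume contra: "\<not> ?thesis"
  define Y where "Y g = B (\<phi> g c) (\<phi> g d)" for g
  define Z where "Z g = B (\<phi> g b) (\<phi> g a)" for g
  note ba = adj_V(3)[OF ab]
  have adjX: "Adj (\<phi> g c) (\<phi> g d)" if "g \<in> carrier G" for g using cd adj_act that by blast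
  have adjZ: "Adj (\<phi> g b) (\<phi> g a)" if "g \<in> carrier G" for g using ba adj_act that by blast
  have Y_V: "Y g \<subseteq> V" if "g \<in> carrier G" for g using halftree_sub[OF adjX[OF that]] by (auto simp: Y_def)
  have meet: "Y g \<inter> Z h \<noteq> {}" if g: "g \<in> carrier G" and h: "h \<in> carrier G" for g h
  proof
    assume e: "Y g \<inter> Z h = {}"
    have k: "inv h \<otimes> g \<in> carrier G" using g h by simp
    have "\<phi> (inv h \<otimes> g) x \<in> B a b" if x: "x \<in> B c d" for x
    proof -
      have xV: "x \<in> V" using x halftree_sub[OF cd] by blast
      have "\<phi> g x \<in> Y g" using halftree_act[OF g cd x] by (simp add: Y_def)
      then have "\<phi> g x \<notin> Z h" using e by blast
      then have "\<phi> h (\<phi> (inv h \<otimes> g) x) \<notin> Z h" using g h xV act_closed by (simp add: act_mult act_inv2)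
      then have "\<phi> (inv h \<otimes> g) x \<notin> B b a" using halftree_act[OF h ba] unfolding Z_def by blast
      then show ?thesis using halftree_cover[OF ab] k xV act_closed by blast
    qed
    then show False using contra k by blast
  qed
  \<comment> \<open>Only a translate of \<open>Y\<close> and a translate of \<open>Z\<close> are
    known to meet, hence two kinds of direction. Two directions of the first kind at the same vertex
    coincide because both coincide with one of the second kind.\<close>
  define dY where "dY y w \<longleftrightarrow> Adj y w \<and> (\<exists>g\<in>carrier G. Y g \<subseteq> B y w)" for y w
  define dZ where "dZ y w \<longleftrightarrow> Adj y w \<and> (\<exists>g\<in>carrier G. Z g \<subseteq> B y w)" for y w
  have exX: "\<exists>w. dY y w" if y: "y \<in> V" for y
  proof -
    obtain g where g: "g \<in> carrier G" "y \<notin> Y g" using minimal_halftrees[OF min cd y] by (auto simp: Y_def)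
    then show ?thesis
      using connected_direction[of "Y g" y] halftree_connected[OF adjX[OF g(1)]] Y_V[OF g(1)] y root_in
      unfolding dY_def Y_def by blast
  qed
  have exZ: "\<exists>w. dZ y w" if y: "y \<in> V" for y
  proof -
    obtain g where g: "g \<in> carrier G" "y \<notin> Z g" using minimal_halftrees[OF min ba y] by (auto simp: Z_def)
    then show ?thesis
      using connected_direction[of "Z g" y] halftree_connected[OF adjZ[OF g(1)]] halftree_sub[OF adjZ[OF g(1)]] y root_in
      unfolding dZ_def Z_def by blast
  qed
  have same: "w = w'" if "dY y w" "dZ y w'" for y w w'
  proof (rule ccontr)
    assume "w \<noteq> w'"
    then have "B y w \<inter> B y w' = {}" using siblings_disjoint that by (auto simp: dY_def dZ_def)
    then show False using that meet unfolding dY_def dZ_def by blast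
  qed
  define \<pi> where "\<pi> y = (SOME w. dY y w)" for y
  have piX: "dY y (\<pi> y)" if "y \<in> V" for y unfolding \<pi>_def using exX[OF that] by (rule someI_ex)
  have piZ: "dZ y (\<pi> y)" if "y \<in> V" for y using exZ[OF that] same piX[OF that] by metis
  have pi_eq: "dY y w \<Longrightarrow> w = \<pi> y" for y w using same piZ adj_V by (metis dY_def)
  have pi_adj: "Adj y (\<pi> y)" if "y \<in> V" for y using piX[OF that] by (simp add: dY_def)
  have pi_V: "\<pi> y \<in> V" if "y \<in> V" for y using pi_adj[OF that] adj_V by blast
  have clash: "B y (\<pi> y) \<inter> B z (\<pi> z) \<noteq> {}" if "y \<in> V" "z \<in> V" for y z
    using piX[OF that(1)] piZ[OF that(2)] meet unfolding dY_def dZ_def by blast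
  have pi2: "\<pi> (\<pi> y) \<noteq> y" if "y \<in> V" for y
    using clash[OF that pi_V[OF that]] halftree_disjoint[OF pi_adj[OF that]] by auto
  \<comment> \<open>If neither vertex pointed to the other, the two directions would diverge from
    the edge and lead into disjoint half-trees, against \<open>clash\<close>.\<close>
  have pi_nbr: "\<pi> y = z \<or> \<pi> z = y" if yz: "Adj y z" for y z
  proof (rule ccontr)
    assume n: "\<not> ?thesis"
    note V = adj_V(1,2)[OF yz]
    have "B z (\<pi> z) \<subseteq> B y z" using halftree_nested[OF yz pi_adj] V n by blast
    moreover have "B y (\<pi> y) \<inter> B y z = {}" using siblings_disjoint[OF pi_adj yz] V n by blast
    ultimately show False using clash V by blast
  qed
  have pi_act: "\<pi> (\<phi> g y) = \<phi> g (\<pi> y)" if g: "g \<in> carrier G" and y: "y \<in> V" for g y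
  proof -
    obtain h where h: "h \<in> carrier G" "Y h \<subseteq> B y (\<pi> y)" using piX[OF y] by (auto simp: dY_def)
    have Ygh: "\<phi> g ` Y h = Y (g \<otimes> h)"
      unfolding Y_def using halftree_act_image[OF g adjX[OF h(1)]] adj_V(1,2)[OF cd] g h by (simp add: act_mult)
    have "Y (g \<otimes> h) \<subseteq> B (\<phi> g y) (\<phi> g (\<pi> y))"
      unfolding Ygh[symmetric] halftree_act_image[OF g pi_adj[OF y], symmetric]
      using h(2) by (rule image_mono)
    then have "dY (\<phi> g y) (\<phi> g (\<pi> y))"
      unfolding dY_def using g h adj_act pi_adj[OF y] m_closed by blast
    then show ?thesis using pi_eq by simp
  qed
  define p where "p y n = (\<pi> ^^ n) y" for y n
  have p_V: "p y n \<in> V" if "y \<in> V" for y n by (induction n) (use that pi_V in \<open>auto simp: p_def\<close>)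
  have p_Suc: "p y (Suc n) = \<pi> (p y n)" for y n by (simp add: p_def)
  have ray: "ray V Adj (p y)" if y: "y \<in> V" for y
  proof -
    have adj: "Adj (p y n) (p y (Suc n))" for n using pi_adj p_V[OF y] by (simp add: p_Suc)
    have "B (p y (Suc n)) (p y (Suc (Suc n))) \<subseteq> B (p y n) (p y (Suc n))" for n
      using halftree_nested[OF adj adj] pi2[OF p_V[OF y]] by (simp add: p_Suc)
    then have mono: "B (p y m) (p y (Suc m)) \<subseteq> B (p y n) (p y (Suc n))" if "n \<le> m" for n m
      using lift_Suc_antimono_le[of "\<lambda>n. B (p y n) (p y (Suc n))"] that by blast
    have "p y n \<noteq> p y m" if nm: "n < m" for n m
    proof -
      obtain k where k: "m = Suc k" "n \<le> k" using nm by (cases m) auto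
      then have "p y m \<in> B (p y n) (p y (Suc n))" using mono[of n k] root_in by blast
      then show ?thesis using halftree_sub[OF adj[of n]] by auto
    qed
    then have "inj (p y)" by (metis injI linorder_neqE_nat)
    then show ?thesis using adj p_V[OF y] by (simp add: ray_def)
  qed
  \<comment> \<open>By \<open>pi_nbr\<close> the forward orbits of adjacent vertices under
    \<open>\<pi>\<close> agree up to a shift, so along a walk any two rays flow together. With the
    equivariance of \<open>\<pi>\<close> this makes their common end invariant.\<close>
  have merge: "\<exists>i j. p y i = p z j" if "y \<in> V" "z \<in> V" for y z
  proof -
    have "(y, z) \<in> (induced Adj V)\<^sup>*" using conn that by blast
    then show ?thesis
    proof (induction rule: rtrancl_induct)
      case (step u w)
      then obtain i j where ij: "p y i = p u j" by blast
      have "\<pi> u = w \<or> \<pi> w = u" using step pi_nbr by (auto simp: induced_def)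
      then show ?case
      proof
        assume "\<pi> u = w"
        then have "p u (Suc j) = p w j" by (simp add: p_def funpow_swap1)
        then have "p y (Suc i) = p w j" using ij by (simp add: p_Suc)
        then show ?thesis by blast
      next
        assume "\<pi> w = u"
        then have "p w (Suc j) = p u j" by (simp add: p_def funpow_swap1)
        then show ?thesis using ij by metis
      qed
    qed blast
  qed
  obtain y where y: "y \<in> V" using adj_V ab by blast
  have "infinite (range (\<phi> g \<circ> p y) \<inter> range (p y))" if g: "g \<in> carrier G" for g
  proof -
    have "\<phi> g (p y n) = p (\<phi> g y) n" for n
    proof (induction n)
      case (Suc n)
      then show ?case using pi_act[OF g p_V[OF y, of n]] by (simp add: p_Suc)
    qed (simp add: p_def)
    then have gp: "\<phi> g \<circ> p y = p (\<phi> g y)" by auto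
    obtain i j where ij: "p (\<phi> g y) i = p y j" using merge[OF act_closed[OF g y] y] by blast
    have "p (\<phi> g y) (n + i) = p y (n + j)" for n
      using ij by (induction n) (auto simp: p_Suc)
    then have "range (\<lambda>n. p y (n + j)) \<subseteq> range (\<phi> g \<circ> p y) \<inter> range (p y)"
      unfolding gp by (metis (no_types, lifting) IntI image_subsetI rangeI)
    moreover have "inj (\<lambda>n. p y (n + j))"
      using ray[OF y] unfolding ray_def inj_def by (metis add_right_cancel)
    then have "infinite (range (\<lambda>n. p y (n + j)))" by (simp add: finite_image_iff)
    ultimately show ?thesis using finite_subset by blast
  qed
  then show False using nend ray[OF y] unfolding fixes_end_def by blast
qed

end

locale general_tree_action = tree_acting_group G V Adj \<phi>
  for G :: "('g, 'b) monoid_scheme" (structure) and V :: "'v set" and Adj and \<phi> +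
  assumes minimal: "minimal_action G V Adj \<phi>" and general: "general_type G V Adj \<phi>"
begin

lemma skewer:
  assumes "Adj a b" "Adj c d" obtains g where "g \<in> carrier G" "\<phi> g ` B c d \<subseteq> B a b"
  using halftree_skewer[OF minimal _ assms] general unfolding general_type_def by blast

section \<open>Half-trees avoiding elliptic and cyclic orbits\<close>

text \<open>The half-tree is thrown into its complement and from there back into itself. If this
  returned all of it, the second element would exchange \<open>a\<close> and \<open>b\<close>, which
  is an inversion.\<close>

lemma smaller_halftree:
  assumes ab: "Adj a b" shows "\<exists>c d. Adj c d \<and> B c d \<subset> B a b"
proof -
  note ba = adj_V(3)[OF ab]
  obtain g where g: "g \<in> carrier G" "\<phi> g ` B a b \<subseteq> B b a" using skewer[OF ba ab] .
  obtain h where h: "h \<in> carrier G" "\<phi> h ` B b a \<subseteq> B a b" using skewer[OF ab ba] .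
  define c d where "c = \<phi> h (\<phi> g a)" and "d = \<phi> h (\<phi> g b)"
  have cd: "Adj c d" using ab g h adj_act by (simp add: c_def d_def)
  have eq: "B c d = \<phi> h ` \<phi> g ` B a b"
    using halftree_act_image g h ab adj_act by (simp add: c_def d_def)
  have "B c d \<noteq> B a b"
  proof
    assume "B c d = B a b"
    then have "\<phi> h ` B b a = B a b" using eq g h by (metis image_mono subset_antisym)
    then have "B (\<phi> h b) (\<phi> h a) = B a b" using halftree_act_image[OF h(1) ba] by simp
    then have "\<phi> h b = a \<and> \<phi> h a = b" using halftree_eqD adj_act[OF h(1) ba] ab by blast
    then show False using no_flip h ab by blast
  qed
  then show ?thesis using cd eq g h by (metis image_mono psubsetI subset_trans)
qed

text \<open>Take a strictly decreasing chain of half-trees that starts with \<open>B a b\<close>,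
  and let \<open>m\<close> be the length of a walk from \<open>a\<close> to \<open>x\<close>. A
  point \<open>y\<close> of \<open>F\<close> in the member at depth \<open>N + m\<close> would be
  separated from \<open>a\<close> by \<open>N + m + 1\<close> edges, but a walk of length at most
  \<open>N + m\<close> joins them.\<close>

lemma halftree_avoiding_bounded:
  assumes ab: "Adj a b" and x: "x \<in> V"
    and F: "\<And>y. y \<in> F \<Longrightarrow> \<exists>n\<le>N. (x, y) \<in> (induced Adj V) ^^ n"
  shows "\<exists>c d. Adj c d \<and> B c d \<subseteq> B a b \<and> B c d \<inter> F = {}"
proof -
  obtain m where m: "(a, x) \<in> (induced Adj V) ^^ m"
    using conn adj_V(1)[OF ab] x by (meson rtrancl_imp_relpow)
  define P where "P e \<longleftrightarrow> Adj (fst e) (snd e)" for e :: "'v \<times> 'v"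
  define T where "T e = B (fst e) (snd e)" for e :: "'v \<times> 'v"
  have "\<exists>e. \<forall>n. (P (e n) \<and> (n = 0 \<longrightarrow> e n = (a, b))) \<and> T (e (Suc n)) \<subset> T (e n)"
    by (rule dependent_nat_choice) (use ab smaller_halftree in \<open>auto simp: P_def T_def\<close>)
  then obtain e where e: "e 0 = (a, b)" "\<And>n. P (e n)" "\<And>n. T (e (Suc n)) \<subset> T (e n)" by metis
  have mono: "T (e j) \<subseteq> T (e i)" if "i \<le> j" for i j
    using lift_Suc_antimono_le[of "\<lambda>n. T (e n)"] e(3) that by blast
  have "T (e j) \<subset> T (e i)" if "i < j" for i j
    using mono[of "Suc i" j] e(3)[of i] that by auto
  then have inj: "inj e" by (metis injI linorder_neqE_nat psubset_eq)
  have "T (e (N + m)) \<inter> F = {}"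
  proof (rule ccontr)
    assume "\<not> ?thesis"
    then obtain y where y: "y \<in> T (e (N + m))" "y \<in> F" by blast
    then obtain n where n: "n \<le> N" "(x, y) \<in> (induced Adj V) ^^ n" using F by blast
    then have "(a, y) \<in> (induced Adj V) ^^ (m + n)" using m by (auto simp: relpow_add)
    then have s: "finite (sep a y)" "card (sep a y) \<le> m + n" using card_sep by auto
    have "e i \<in> sep a y" if "i \<le> N + m" for i
    proof -
      have "y \<in> T (e i)" using mono[OF that] y by blast
      moreover have "a \<notin> T (e i)" using mono[of 0 i] e(1) halftree_sub[OF ab] by (auto simp: T_def)
      ultimately show ?thesis using e(2)[of i] by (auto simp: sep_def T_def P_def)
    qed
    then have "e ` {..N + m} \<subseteq> sep a y" by auto
    then have "card (e ` {..N + m}) \<le> m + n" using s card_mono le_trans by blast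
    moreover have "card (e ` {..N + m}) = Suc (N + m)"
      using inj by (simp add: card_image inj_on_subset)
    ultimately show False using n by simp
  qed
  then show ?thesis
    using e(2)[of "N + m"] mono[of 0 "N + m"] e(1) by (auto simp: P_def T_def)
qed

lemma halftree_avoiding_finite:
  assumes "Adj a b" "finite F" "F \<subseteq> V"
  shows "\<exists>c d. Adj c d \<and> B c d \<subseteq> B a b \<and> B c d \<inter> F = {}"
proof -
  have a: "a \<in> V" using assms adj_V by blast
  have "\<forall>y\<in>F. \<exists>n. (a, y) \<in> (induced Adj V) ^^ n"
    using conn a assms by (meson rtrancl_imp_relpow subsetD)
  then obtain n where n: "\<And>y. y \<in> F \<Longrightarrow> (a, y) \<in> (induced Adj V) ^^ n y" by metis
  have "n y \<le> Max (n ` F)" if "y \<in> F" for y using assms that by simp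
  then show ?thesis using halftree_avoiding_bounded[OF assms(1) a, of F "Max (n ` F)"] n by blast
qed

lemma relpow_act:
  assumes "g \<in> carrier G" "(x, y) \<in> (induced Adj V) ^^ n"
  shows "(\<phi> g x, \<phi> g y) \<in> (induced Adj V) ^^ n"
  using assms(2)
proof (induction n arbitrary: y)
  case (Suc n)
  then obtain z where "(x, z) \<in> (induced Adj V) ^^ n" "(z, y) \<in> induced Adj V" by auto
  moreover from this have "(\<phi> g z, \<phi> g y) \<in> induced Adj V"
    using adj_act act_closed assms(1) by (auto simp: induced_def)
  ultimately show ?case using Suc.IH by auto
qed simp

text \<open>The action preserves lengths of walks and \<open>L\<close> fixes \<open>x\<close>, so
  the \<open>L\<close>-translates of a finite set stay within bounded distance of
  \<open>x\<close>.\<close>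

lemma halftree_avoiding_elliptic:
  assumes ab: "Adj a b" and L: "L \<subseteq> carrier G" and x: "x \<in> V" "\<And>h. h \<in> L \<Longrightarrow> \<phi> h x = x"
    and F: "finite F" "F \<subseteq> V"
  shows "\<exists>c d. Adj c d \<and> B c d \<inter> {\<phi> h y | h y. h \<in> L \<and> y \<in> F} = {}"
proof -
  have "\<forall>y\<in>F. \<exists>n. (x, y) \<in> (induced Adj V) ^^ n"
    using conn x F by (meson rtrancl_imp_relpow subsetD)
  then obtain n where n: "\<And>y. y \<in> F \<Longrightarrow> (x, y) \<in> (induced Adj V) ^^ n y" by metis
  have le: "n y \<le> Max (n ` F)" if "y \<in> F" for y using F that by simp
  have "\<exists>k\<le>Max (n ` F). (x, z) \<in> (induced Adj V) ^^ k" if z: "z \<in> {\<phi> h y | h y. h \<in> L \<and> y \<in> F}" for z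
  proof -
    obtain h y where hy: "h \<in> L" "y \<in> F" "z = \<phi> h y" using z by blast
    then have "(\<phi> h x, \<phi> h y) \<in> (induced Adj V) ^^ n y" using relpow_act n L by blast
    then show ?thesis using hy x le by auto
  qed
  from halftree_avoiding_bounded[OF ab x(1) this] show ?thesis by blast
qed

text \<open>If a positive power \<open>g [^] k\<close> fixes a vertex, the orbit consists of the
  translates of \<open>k\<close> points by an elliptic group. Otherwise \<open>g\<close> acts as a
  hyperbolic element, and the two tails of the orbit are compared with three disjoint
  half-trees.\<close>

lemma halftree_avoiding_cyclic:
  assumes g: "g \<in> carrier G" and v: "v \<in> V" and ab: "Adj a b"
  shows "\<exists>c d. Adj c d \<and> B c d \<inter> {\<phi> (g [^] n) v | n :: int. True} = {}"
proof (cases "\<exists>k>0. \<exists>x\<in>V. \<phi> (g [^] (k::int)) x = x")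
  case True
  then obtain k x where k: "k > 0" "x \<in> V" "\<phi> (g [^] (k::int)) x = x" by blast
  define L where "L = {h \<in> carrier G. \<phi> h x = x}"
  have kn: "(g [^] k) [^] (m :: int) \<in> L" for m
  proof -
    have sub: "subgroup L G"
      using k(2) by (intro subgroupI) (auto simp: L_def act_mult act_one intro!: exI[of _ \<one>], metis act_inv1)
    have "g [^] k \<in> L" using k g by (simp add: L_def)
    then show ?thesis by (rule subgroup_int_pow_closed[OF sub])
  qed
  define F where "F = (\<lambda>i. \<phi> (g [^] i) v) ` {0..<k}"
  have "finite F" "F \<subseteq> V" using g v act_closed by (auto simp: F_def)
  moreover have "{\<phi> (g [^] n) v | n :: int. True} \<subseteq> {\<phi> h y | h y. h \<in> L \<and> y \<in> F}"
  proof clarify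
    fix n :: int
    have "g [^] n = (g [^] k) [^] (n div k) \<otimes> g [^] (n mod k)"
      using g by (simp add: int_pow_pow int_pow_mult flip: int_pow_mult)
    then have "\<phi> (g [^] n) v = \<phi> ((g [^] k) [^] (n div k)) (\<phi> (g [^] (n mod k)) v)"
      using g v by (simp add: act_mult)
    moreover have "\<phi> (g [^] (n mod k)) v \<in> F" using k by (auto simp: F_def)
    ultimately show "\<exists>h y. \<phi> (g [^] n) v = \<phi> h y \<and> h \<in> L \<and> y \<in> F" using kn by blast
  qed
  moreover have "\<exists>c d. Adj c d \<and> B c d \<inter> {\<phi> h y | h y. h \<in> L \<and> y \<in> F} = {}"
    using halftree_avoiding_elliptic[OF ab _ k(2) _ \<open>finite F\<close> \<open>F \<subseteq> V\<close>, of L] unfolding L_def by blast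
  ultimately show ?thesis by blast
next
  case False
  define y where "y n = \<phi> (g [^] n) v" for n :: int
  have yV: "y n \<in> V" for n using g v act_closed by (simp add: y_def)
  text \<open>A boundary edge crossed infinitely often would be fixed by a power of \<open>g\<close>, so the orbit
    has only two ends and some of three disjoint half-trees contains finitely many of its points.\<close>
  have crossing: "finite {n. (y n \<in> B c d) \<noteq> (y (n + 1) \<in> B c d)}" if cd: "Adj c d" for c d
  proof (rule ccontr)
    define C where "C = {n. (y n \<in> B c d) \<noteq> (y (n + 1) \<in> B c d)}"
    assume "infinite {n. (y n \<in> B c d) \<noteq> (y (n + 1) \<in> B c d)}"
    then have inf: "infinite C" by (simp add: C_def)
    \<comment> \<open>Pulling the edge back by \<open>g [^] n\<close> sends every crossing to one of
      the finitely many edges between \<open>v\<close> and \<open>\<phi> g v\<close>. A coincidence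
      \<open>f m = f n\<close> lets \<open>g [^] (n - m)\<close> fix a vertex.\<close>
    define f where "f n = (\<phi> (inv (g [^] n)) c, \<phi> (inv (g [^] n)) d)" for n :: int
    have "f ` C \<subseteq> sep v (\<phi> g v) \<union> sep (\<phi> g v) v"
    proof (intro image_subsetI)
      fix n assume n: "n \<in> C"
      have "y (n + 1) = \<phi> (g [^] n) (\<phi> g v)"
        using g v by (simp add: y_def int_pow_mult act_mult)
      then have "(c, d) \<in> sep (\<phi> (g [^] n) v) (\<phi> (g [^] n) (\<phi> g v)) \<or>
          (c, d) \<in> sep (\<phi> (g [^] n) (\<phi> g v)) (\<phi> (g [^] n) v)"
        using n cd by (auto simp: C_def sep_def y_def)
      then show "f n \<in> sep v (\<phi> g v) \<union> sep (\<phi> g v) v"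
        using sep_act[of "g [^] n"] g v act_closed unfolding f_def by blast
    qed
    then have "finite (f ` C)" using finite_sep g v act_closed by (meson finite_UnI finite_subset)
    then have "\<not> inj_on f C" using inf finite_imageD by blast
    then obtain m n where mn: "f m = f n" "m < n"
      unfolding inj_on_def by (metis linorder_neqE)
    note cV = adj_V(1)[OF cd]
    define z where "z = \<phi> (inv (g [^] n)) c"
    have z: "z \<in> V" using g cV act_closed by (simp add: z_def)
    have "\<phi> (g [^] n) z = c" "\<phi> (g [^] m) z = c"
      using mn g cV by (auto simp: z_def f_def act_inv2) (metis act_inv2 int_pow_closed)
    moreover have "g [^] n = g [^] m \<otimes> g [^] (n - m)" using g by (simp add: int_pow_mult[symmetric])
    ultimately have "\<phi> (g [^] m) (\<phi> (g [^] (n - m)) z) = \<phi> (g [^] m) z"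
      using g z by (simp add: act_mult)
    then have "\<phi> (g [^] (n - m)) z = z" using act_inj g z act_closed int_pow_closed by metis
    then show False using False mn z by (metis diff_gt_0_iff_gt)
  qed
  have eventually_const: "\<exists>M>0. (\<forall>n\<ge>M. (y n \<in> B c d) = (y M \<in> B c d)) \<and> (\<forall>n\<ge>M. (y (- n) \<in> B c d) = (y (- M) \<in> B c d))"
    if cd: "Adj c d" for c d
  proof -
    define C where "C = {n. (y n \<in> B c d) \<noteq> (y (n + 1) \<in> B c d)}"
    have fin: "finite C" using crossing[OF cd] by (simp add: C_def)
    define M where "M = Max (insert 0 (abs ` C)) + 1"
    have le: "i \<le> Max (insert 0 (abs ` C))" if "i \<in> insert 0 (abs ` C)" for i
      using fin that by (intro Max_ge) auto
    have out: "n \<notin> C" if "abs n \<ge> M" for n using that le[of "abs n"] by (auto simp: M_def)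
    have M: "M > 0" using le[of 0] by (simp add: M_def)
    have "(y n \<in> B c d) = (y M \<in> B c d)" if "n \<ge> M" for n
      using that
    proof (induction n rule: int_ge_induct)
      case (step i)
      then show ?case using out[of i] M by (auto simp: C_def)
    qed simp
    moreover have "(y (- n) \<in> B c d) = (y (- M) \<in> B c d)" if "n \<ge> M" for n
      using that
    proof (induction n rule: int_ge_induct)
      case (step i)
      then show ?case using out[of "- i - 1"] M by (auto simp: C_def)
    qed simp
    ultimately show ?thesis using M by blast
  qed
  have fin_or: "finite {n. y n \<in> B c d} \<or> (\<exists>M. \<forall>n\<ge>M. y n \<in> B c d) \<or> (\<exists>M. \<forall>n\<ge>M. y (- n) \<in> B c d)"
    if cd: "Adj c d" for c d
  proof -
    obtain M where M: "M > 0" "\<forall>n\<ge>M. (y n \<in> B c d) = (y M \<in> B c d)"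
      "\<forall>n\<ge>M. (y (- n) \<in> B c d) = (y (- M) \<in> B c d)" using eventually_const[OF cd] by blast
    show ?thesis
    proof (cases "y M \<in> B c d \<or> y (- M) \<in> B c d")
      case False
      have "{n. y n \<in> B c d} \<subseteq> {- M..M}"
      proof
        fix n assume "n \<in> {n. y n \<in> B c d}"
        then have n: "y n \<in> B c d" by simp
        have "\<not> n \<ge> M" using M(2) False n by blast
        moreover have "\<not> - n \<ge> M" using M(3) False n by (metis minus_minus)
        ultimately show "n \<in> {- M..M}" by simp
      qed
      then show ?thesis using finite_subset by blast
    qed (use M in blast)
  qed
  define pos where "pos A \<longleftrightarrow> (\<exists>M. \<forall>n\<ge>M. y n \<in> A)" for A
  define neg where "neg A \<longleftrightarrow> (\<exists>M. \<forall>n\<ge>M. y (- n) \<in> A)" for A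
  have pos_neg: "\<not> (pos A \<and> pos A')" "\<not> (neg A \<and> neg A')" if "A \<inter> A' = {}" for A A'
    using that max.cobounded1 max.cobounded2 unfolding pos_def neg_def by (metis disjoint_iff)+
  obtain p q s where "ray V Adj p" "ray V Adj q" "ray V Adj s"
    "\<not> same_end p q" "\<not> same_end p s" "\<not> same_end q s"
    using general unfolding general_type_def by blast
  from three_halftrees[OF this] obtain a1 b1 a2 b2 a3 b3 where e: "Adj a1 b1" "Adj a2 b2" "Adj a3 b3"
    "B a1 b1 \<inter> B a2 b2 = {}" "B a1 b1 \<inter> B a3 b3 = {}" "B a2 b2 \<inter> B a3 b3 = {}" by blast
  have "finite {n. y n \<in> B a1 b1} \<or> finite {n. y n \<in> B a2 b2} \<or> finite {n. y n \<in> B a3 b3}"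
    using fin_or[OF e(1)] fin_or[OF e(2)] fin_or[OF e(3)] pos_neg[OF e(4)] pos_neg[OF e(5)] pos_neg[OF e(6)]
    unfolding pos_def[symmetric] neg_def[symmetric] by argo
  then obtain c d where cd: "Adj c d" "finite {n. y n \<in> B c d}" using e(1-3) by blast
  have "finite (y ` {n. y n \<in> B c d})" "y ` {n. y n \<in> B c d} \<subseteq> V" using cd yV by auto
  from halftree_avoiding_finite[OF cd(1) this] obtain c' d' where
    "Adj c' d'" "B c' d' \<subseteq> B c d" "B c' d' \<inter> y ` {n. y n \<in> B c d} = {}" by blast
  then have "Adj c' d' \<and> B c' d' \<inter> {\<phi> (g [^] n) v | n :: int. True} = {}"
    by (auto simp: y_def)
  then show ?thesis by blast
qed

text \<open>If the orbit of \<open>v\<close> under \<open>L\<close> misses a half-tree, it lies in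
  the complementary one, and \<open>skewer\<close> moves that half-tree into
  \<open>B a b\<close>.\<close>

lemma coset_into_halftree:
  assumes v: "v \<in> V" and ab: "Adj a b"
    and L: "(\<exists>g\<in>carrier G. L = generate G {g}) \<or> (subgroup L G \<and> acts_elliptically G V \<phi> L)"
  shows "\<exists>g\<in>carrier G. \<forall>h\<in>L. \<phi> (g \<otimes> h) v \<in> B a b"
proof -
  have LG: "L \<subseteq> carrier G"
    using L by (metis generate_incl empty_subsetI insert_subset subgroup.subset)
  have "\<exists>c d. Adj c d \<and> B c d \<inter> {\<phi> h v | h. h \<in> L} = {}"
    using L
  proof
    assume "\<exists>g\<in>carrier G. L = generate G {g}"
    then obtain g where g: "g \<in> carrier G" "L = {g [^] n | n :: int. True}"
      by (auto simp: generate_pow)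
    then have "{\<phi> h v | h. h \<in> L} = {\<phi> (g [^] n) v | n :: int. True}" by blast
    then show ?thesis using halftree_avoiding_cyclic[OF g(1) v ab] by simp
  next
    assume "subgroup L G \<and> acts_elliptically G V \<phi> L"
    then obtain x where "x \<in> V" "\<And>h. h \<in> L \<Longrightarrow> \<phi> h x = x" by (auto simp: acts_elliptically_def)
    from halftree_avoiding_elliptic[OF ab LG this, of "{v}"] v show ?thesis by simp
  qed
  then obtain c d where cd: "Adj c d" "B c d \<inter> {\<phi> h v | h. h \<in> L} = {}" by blast
  obtain g where g: "g \<in> carrier G" "\<phi> g ` B d c \<subseteq> B a b" using skewer[OF ab adj_V(3)[OF cd(1)]] .
  have "\<phi> (g \<otimes> h) v \<in> B a b" if h: "h \<in> L" for h
  proof -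
    have "\<phi> h v \<in> B d c" using cd h halftree_cover[OF cd(1) act_closed[of h v]] LG v by blast
    then have "\<phi> g (\<phi> h v) \<in> B a b" using g by blast
    then show ?thesis using g(1) h LG v act_mult[of g h v] by auto
  qed
  then show ?thesis using g by blast
qed

end

section \<open>Coarse paths and positive cones\<close>

text \<open>The Cayley graph for the steps \<open>D\<close>, with edges in both directions,
  restricted to \<open>A\<close>. Coarse paths become its transitive closure; with an arbitrary
  finite \<open>D\<close> in place of a radius, changes of generating set and passages to subgroups
  need no comparison of word metrics.\<close>

definition step_rel :: "('g, 'b) monoid_scheme \<Rightarrow> 'g set \<Rightarrow> 'g set \<Rightarrow> ('g \<times> 'g) set" where
  "step_rel K D A = {(x, y). x \<in> A \<and> y \<in> A \<and>
     (inv\<^bsub>K\<^esub> x \<otimes>\<^bsub>K\<^esub> y \<in> D \<or> inv\<^bsub>K\<^esub> y \<otimes>\<^bsub>K\<^esub> x \<in> D)}"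

lemma sym_step_rel: "sym (step_rel K D A)"
  by (auto simp: sym_def step_rel_def)

lemma step_rel_rtrancl_sym: "(x, y) \<in> (step_rel K D A)\<^sup>* \<Longrightarrow> (y, x) \<in> (step_rel K D A)\<^sup>*"
  by (meson sym_step_rel sym_rtrancl symD)

lemma step_rel_mono: "D \<subseteq> D' \<Longrightarrow> A \<subseteq> A' \<Longrightarrow> step_rel K D A \<subseteq> step_rel K D' A'"
  by (auto simp: step_rel_def)

lemma (in group) cancel_inv:
  "a \<in> carrier G \<Longrightarrow> b \<in> carrier G \<Longrightarrow> inv a \<otimes> (a \<otimes> b) = b"
  "a \<in> carrier G \<Longrightarrow> b \<in> carrier G \<Longrightarrow> a \<otimes> (inv a \<otimes> b) = b"
  by (simp_all flip: m_assoc)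

lemma (in group) step_rel_subgroup:
  assumes "subgroup K G" "A \<subseteq> K"
  shows "step_rel (G\<lparr>carrier := K\<rparr>) D A = step_rel G D A"
  using assms m_inv_consistent by (auto simp: step_rel_def subset_iff)

lemma (in group) foldr_closed: "set ws \<subseteq> carrier G \<Longrightarrow> foldr (\<otimes>) ws \<one> \<in> carrier G"
  by (induction ws) auto

lemma (in group) foldr_append_mult:
  "set us \<subseteq> carrier G \<Longrightarrow> set ws \<subseteq> carrier G \<Longrightarrow>
    foldr (\<otimes>) (us @ ws) \<one> = foldr (\<otimes>) us \<one> \<otimes> foldr (\<otimes>) ws \<one>"
  by (induction us) (simp_all add: foldr_closed m_assoc del: foldr_append)

lemma (in group) generate_word:
  assumes "Sg \<subseteq> carrier G" "g \<in> generate G Sg"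
  shows "\<exists>ws. set ws \<subseteq> Sg \<union> m_inv G ` Sg \<and> foldr (\<otimes>) ws \<one> = g"
  using assms(2)
proof (induction rule: generate.induct)
  case one
  show ?case by (intro exI[of _ "[]"]) simp
next
  case (incl h)
  then show ?case using assms(1) by (intro exI[of _ "[h]"]) auto
next
  case (inv h)
  then show ?case using assms(1) by (intro exI[of _ "[inv h]"]) auto
next
  case (eng h1 h2)
  then obtain u w where uw: "set u \<subseteq> Sg \<union> m_inv G ` Sg" "foldr (\<otimes>) u \<one> = h1"
    "set w \<subseteq> Sg \<union> m_inv G ` Sg" "foldr (\<otimes>) w \<one> = h2" by blast
  moreover have A: "Sg \<union> m_inv G ` Sg \<subseteq> carrier G" using assms(1) by auto
  ultimately have "foldr (\<otimes>) (u @ w) \<one> = h1 \<otimes> h2"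
    using foldr_append_mult[OF order_trans[OF uw(1) A] order_trans[OF uw(3) A]] by simp
  then show ?case using uw by (intro exI[of _ "u @ w"]) auto
qed

lemma (in group) finite_word_ball:
  assumes "gen_set G Sg" shows "finite {g \<in> carrier G. real (word_len G Sg g) \<le> r}"
proof -
  define A where "A = Sg \<union> m_inv G ` Sg"
  have A: "finite A" using assms by (simp add: A_def gen_set_def)
  have "{g \<in> carrier G. real (word_len G Sg g) \<le> r} \<subseteq>
      (\<lambda>ws. foldr (\<otimes>) ws \<one>) ` {ws. set ws \<subseteq> A \<and> length ws \<le> nat \<lfloor>r\<rfloor>}"
  proof
    fix g assume "g \<in> {g \<in> carrier G. real (word_len G Sg g) \<le> r}"
    then have g: "g \<in> carrier G" "real (word_len G Sg g) \<le> r" by auto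
    have "\<exists>n ws. length ws = n \<and> set ws \<subseteq> A \<and> foldr (\<otimes>) ws \<one> = g"
      using generate_word[of Sg g] assms g by (auto simp: gen_set_def A_def)
    then have "\<exists>ws. length ws = word_len G Sg g \<and> set ws \<subseteq> A \<and> foldr (\<otimes>) ws \<one> = g"
      unfolding word_len_def A_def by (rule LeastI_ex)
    moreover have "word_len G Sg g \<le> nat \<lfloor>r\<rfloor>" using g(2) by linarith
    ultimately show "g \<in> (\<lambda>ws. foldr (\<otimes>) ws \<one>) ` {ws. set ws \<subseteq> A \<and> length ws \<le> nat \<lfloor>r\<rfloor>}"
      by force
  qed
  then show ?thesis using finite_lists_length_le[OF A] finite_subset by blast
qed

lemma (in group) r_path_step_rel:
  assumes "r_path G Sg r ps" "set ps \<subseteq> A"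
  shows "(hd ps, last ps) \<in> (step_rel G {g \<in> carrier G. real (word_len G Sg g) \<le> r} A)\<^sup>*"
  using assms
proof (induction ps)
  case (Cons x ps)
  show ?case
  proof (cases ps)
    case (Cons y ys)
    have "r_path G Sg r ps" unfolding r_path_def
    proof (intro conjI allI impI)
      fix i assume "Suc i < length ps"
      then show "real (word_dist G Sg (ps ! i) (ps ! Suc i)) \<le> r"
        using Cons.prems(1) unfolding r_path_def by (auto dest!: spec[of _ "Suc i"])
    qed (use Cons.prems Cons in \<open>auto simp: r_path_def\<close>)
    then have "(y, last ps) \<in> (step_rel G {g \<in> carrier G. real (word_len G Sg g) \<le> r} A)\<^sup>*"
      using Cons.IH Cons.prems Cons by simp
    moreover have "(x, y) \<in> step_rel G {g \<in> carrier G. real (word_len G Sg g) \<le> r} A"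
      using Cons.prems Cons by (auto simp: r_path_def step_rel_def word_dist_def dest: spec[of _ 0])
    ultimately show ?thesis using Cons by (simp add: converse_rtrancl_into_rtrancl)
  qed simp
qed (simp add: r_path_def)

text \<open>Converse of \<open>r_path_step_rel\<close>: a finite step set is contained in steps of
  bounded word length, and one \<open>r\<close> serves all sets \<open>A\<close>.\<close>

lemma (in group) step_rel_r_path:
  assumes "finite D" "D \<subseteq> carrier G"
  obtains r where "r > 0"
    "\<And>A x y. A \<subseteq> carrier G \<Longrightarrow> x \<in> A \<Longrightarrow> (x, y) \<in> (step_rel G D A)\<^sup>* \<Longrightarrow>
      \<exists>ps. r_path G Sg r ps \<and> hd ps = x \<and> last ps = y \<and> set ps \<subseteq> A"
proof -
  \<comment> \<open>Inserting 1 makes \<open>Max\<close> meaningful for empty \<open>D\<close> and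
    keeps \<open>r\<close> positive.\<close>
  define r where "r = real (Max (insert 1 (word_len G Sg ` (D \<union> m_inv G ` D))))"
  have r: "real (word_len G Sg g) \<le> r" if "g \<in> D \<union> m_inv G ` D" for g
    unfolding r_def of_nat_le_iff using assms that by (intro Max_ge) auto
  have "1 \<le> Max (insert 1 (word_len G Sg ` (D \<union> m_inv G ` D)))" using assms by (intro Max_ge) auto
  then have pos: "r > 0" by (simp add: r_def)
  moreover have "\<exists>ps. r_path G Sg r ps \<and> hd ps = x \<and> last ps = y \<and> set ps \<subseteq> A"
    if A: "A \<subseteq> carrier G" and x: "x \<in> A" and xy: "(x, y) \<in> (step_rel G D A)\<^sup>*" for A x y
    using xy
  proof (induction rule: rtrancl_induct)
    case base
    show ?case using x A by (intro exI[of _ "[x]"]) (auto simp: r_path_def)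
  next
    case (step y z)
    then obtain ps where ps: "r_path G Sg r ps" "hd ps = x" "last ps = y" "set ps \<subseteq> A" by blast
    have ne: "ps \<noteq> []" using ps by (simp add: r_path_def)
    have yz: "y \<in> A" "z \<in> A" "inv y \<otimes> z \<in> D \<or> inv z \<otimes> y \<in> D" using step by (auto simp: step_rel_def)
    have "inv y \<otimes> z \<in> D \<union> m_inv G ` D"
    proof (cases "inv y \<otimes> z \<in> D")
      case False
      then have "inv (inv z \<otimes> y) \<in> m_inv G ` D" using yz by blast
      then show ?thesis using yz A by (auto simp: inv_mult_group subset_iff)
    qed simp
    then have d: "real (word_dist G Sg y z) \<le> r" using r by (simp add: word_dist_def)
    have "r_path G Sg r (ps @ [z])" unfolding r_path_def
    proof (intro conjI allI impI)
      fix i assume i: "Suc i < length (ps @ [z])"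
      show "real (word_dist G Sg ((ps @ [z]) ! i) ((ps @ [z]) ! Suc i)) \<le> r"
      proof (cases "Suc i < length ps")
        case True
        then show ?thesis using ps(1) by (simp add: r_path_def nth_append)
      next
        case False
        then have "i = length ps - 1" using i by simp
        then show ?thesis using d ps(3) ne by (simp add: nth_append last_conv_nth)
      qed
    qed (use ps yz A in auto)
    then show ?case using ps yz ne by (intro exI[of _ "ps @ [z]"]) auto
  qed
  ultimately show thesis by (rule that)
qed

section \<open>Left orders given by positive cones\<close>

lemma (in group) positive_coneD:
  assumes "positive_cone G P"
  shows "P \<subseteq> carrier G" "a \<in> P \<Longrightarrow> b \<in> P \<Longrightarrow> a \<otimes> b \<in> P" "\<one> \<notin> P"
    "a \<in> carrier G \<Longrightarrow> a \<in> P \<or> inv a \<in> P \<or> a = \<one>"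
proof -
  show "P \<subseteq> carrier G" "a \<in> P \<Longrightarrow> b \<in> P \<Longrightarrow> a \<otimes> b \<in> P" "\<one> \<notin> P"
    using assms by (auto simp: positive_cone_def)
  have "carrier G = P \<union> m_inv G ` P \<union> {\<one>}" "P \<subseteq> carrier G" using assms by (auto simp: positive_cone_def)
  then show "a \<in> P \<or> inv a \<in> P \<or> a = \<one>" if "a \<in> carrier G"
    using that by auto
qed

lemma (in group) positive_coneI:
  assumes sub: "P \<subseteq> carrier G" and mult: "\<And>a b. a \<in> P \<Longrightarrow> b \<in> P \<Longrightarrow> a \<otimes> b \<in> P" and one: "\<one> \<notin> P"
    and tot: "\<And>a. a \<in> carrier G \<Longrightarrow> a \<in> P \<or> inv a \<in> P \<or> a = \<one>"
  shows "positive_cone G P"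
proof -
  have disj: "inv a \<notin> P" if "a \<in> P" for a using mult[OF that] one that sub by (metis r_inv subsetD)
  have "carrier G \<subseteq> P \<union> m_inv G ` P \<union> {\<one>}"
  proof
    fix a assume a: "a \<in> carrier G"
    then have "inv a \<in> P \<Longrightarrow> a \<in> m_inv G ` P" by (metis image_eqI inv_inv)
    then show "a \<in> P \<union> m_inv G ` P \<union> {\<one>}" using tot[OF a] by blast
  qed
  moreover have "P \<union> m_inv G ` P \<union> {\<one>} \<subseteq> carrier G" using sub by auto
  moreover have "\<one> \<notin> m_inv G ` P" using one sub by (metis imageE inv_inv inv_one subsetD)
  ultimately show ?thesis using disj sub mult one by (auto simp: positive_cone_def)
qed

locale left_ordered_group = group G for G :: "('g, 'b) monoid_scheme" (structure) +
  fixes P :: "'g set"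
  assumes cone: "positive_cone G P"
begin

text \<open>The order of the cone is invariant under multiplication on the left only; factors on the
  right have to be controlled separately.\<close>

definition le :: "'g \<Rightarrow> 'g \<Rightarrow> bool"  (infix "\<sqsubseteq>" 50) where
  "a \<sqsubseteq> b \<longleftrightarrow> inv a \<otimes> b \<in> insert \<one> P"

lemma P_closed: "p \<in> P \<Longrightarrow> p \<in> carrier G"
  using positive_coneD(1)[OF cone] by blast

lemma le_refl: "a \<in> carrier G \<Longrightarrow> a \<sqsubseteq> a"
  by (simp add: le_def)

lemma le_trans:
  assumes "a \<in> carrier G" "b \<in> carrier G" "c \<in> carrier G" "a \<sqsubseteq> b" "b \<sqsubseteq> c"
  shows "a \<sqsubseteq> c"
proof -
  have "inv a \<otimes> c = (inv a \<otimes> b) \<otimes> (inv b \<otimes> c)" using assms by (simp add: m_assoc cancel_inv)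
  then show ?thesis using assms positive_coneD(2)[OF cone] by (auto simp: le_def)
qed

lemma le_total: "a \<in> carrier G \<Longrightarrow> b \<in> carrier G \<Longrightarrow> a \<sqsubseteq> b \<or> b \<sqsubseteq> a"
  using positive_coneD(4)[OF cone, of "inv a \<otimes> b"] by (auto simp: le_def inv_mult_group)

lemma le_antisym:
  assumes "a \<in> carrier G" "b \<in> carrier G" "a \<sqsubseteq> b" "b \<sqsubseteq> a" shows "a = b"
proof (rule ccontr)
  assume "a \<noteq> b"
  have eq: "x = y" if "x \<in> carrier G" "y \<in> carrier G" "inv x \<otimes> y = \<one>" for x y
    using cancel_inv(2)[OF that(1,2)] that by simp
  have "inv a \<otimes> b \<noteq> \<one>" "inv b \<otimes> a \<noteq> \<one>" using eq[OF assms(1,2)] eq[OF assms(2,1)] \<open>a \<noteq> b\<close> by blast+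
  then have "inv a \<otimes> b \<in> P" "inv b \<otimes> a \<in> P" using assms(3,4) unfolding le_def by blast+
  then have "(inv a \<otimes> b) \<otimes> (inv b \<otimes> a) \<in> P" using positive_coneD(2)[OF cone] by blast
  moreover have "(inv a \<otimes> b) \<otimes> (inv b \<otimes> a) = \<one>" using assms by (simp add: m_assoc cancel_inv)
  ultimately show False using positive_coneD(3)[OF cone] by simp
qed

lemma le_mult:
  assumes "g \<in> carrier G" "a \<in> carrier G" "b \<in> carrier G"
  shows "g \<otimes> a \<sqsubseteq> g \<otimes> b \<longleftrightarrow> a \<sqsubseteq> b"
proof -
  have "inv (g \<otimes> a) \<otimes> (g \<otimes> b) = inv a \<otimes> b"
    using assms by (simp add: inv_mult_group m_assoc cancel_inv)
  then show ?thesis by (simp add: le_def)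
qed

lemma finite_upper_bound:
  assumes "finite F" "F \<subseteq> carrier G"
  shows "\<exists>m\<in>carrier G. \<forall>x\<in>F. x \<sqsubseteq> m"
  using assms
proof (induction F)
  case (insert x F)
  then obtain m where m: "m \<in> carrier G" "\<forall>y\<in>F. y \<sqsubseteq> m" by auto
  have xF: "x \<in> carrier G" "F \<subseteq> carrier G" using insert by auto
  show ?case
  proof (cases "x \<sqsubseteq> m")
    case False
    then have "m \<sqsubseteq> x" using le_total m xF by blast
    have "y \<sqsubseteq> x" if "y \<in> insert x F" for y
    proof (cases "y = x")
      case False
      then have "y \<in> carrier G" "y \<sqsubseteq> m" using that m xF by auto
      then show ?thesis using le_trans[OF _ m(1) xF(1)] \<open>m \<sqsubseteq> x\<close> by blast
    qed (use le_refl xF in simp)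
    then show ?thesis using xF by blast
  qed (use m in auto)
qed auto

text \<open>This is the trace on \<open>K\<close> of the conjugate cone \<open>d P d^-1\<close>. It
  orders \<open>K\<close> by comparing the translates \<open>g \<otimes> d\<close>, so that
  \<open>d\<close> takes the place of the identity as base point.\<close>

lemma subgroup_cone:
  assumes K: "subgroup K G" and d: "d \<in> carrier G"
  shows "positive_cone (G\<lparr>carrier := K\<rparr>) {g \<in> K. inv d \<otimes> g \<otimes> d \<in> P}"
proof -
  interpret K: group "G\<lparr>carrier := K\<rparr>" using subgroup.subgroup_is_group[OF K group_axioms] .
  have KG: "g \<in> carrier G" if "g \<in> K" for g using subgroup.subset[OF K] that by blast
  show ?thesis
  proof (rule K.positive_coneI, goal_cases)
    case (2 a b)
    then have ab: "a \<in> K" "b \<in> K" by auto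
    have "inv d \<otimes> (a \<otimes> b) \<otimes> d = (inv d \<otimes> a \<otimes> d) \<otimes> (inv d \<otimes> b \<otimes> d)"
      using ab KG d by (simp add: m_assoc cancel_inv)
    then show ?case using 2 positive_coneD(2)[OF cone] subgroup.m_closed[OF K] by auto
  next
    case 3
    then show ?case using d positive_coneD(3)[OF cone] by simp
  next
    case (4 a)
    then have a: "a \<in> K" by simp
    have i: "inv\<^bsub>G\<lparr>carrier := K\<rparr>\<^esub> a = inv a" using m_inv_consistent[OF K a] .
    have "inv (inv d \<otimes> a \<otimes> d) = inv d \<otimes> inv a \<otimes> d"
      using a KG d by (simp add: inv_mult_group m_assoc)
    moreover have "a = \<one>" if "inv d \<otimes> a \<otimes> d = \<one>"
    proof -
      have "d \<otimes> (inv d \<otimes> a \<otimes> d) \<otimes> inv d = a" using a KG d by (simp add: m_assoc cancel_inv)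
      then show ?thesis using that d by simp
    qed
    ultimately show ?case
      using positive_coneD(4)[OF cone, of "inv d \<otimes> a \<otimes> d"] a KG d i subgroup.m_inv_closed[OF K a] by auto
  qed auto
qed

lemma subgroup_cone_iff:
  assumes "subgroup K G" "d \<in> carrier G" "g \<in> K"
  shows "g \<in> insert \<one> {g \<in> K. inv d \<otimes> g \<otimes> d \<in> P} \<longleftrightarrow> d \<sqsubseteq> g \<otimes> d"
proof -
  have g: "g \<in> carrier G" using assms subgroup.subset by blast
  have "inv d \<otimes> g \<otimes> d = \<one> \<longleftrightarrow> g = \<one>"
  proof
    assume "inv d \<otimes> g \<otimes> d = \<one>"
    then have "d \<otimes> (inv d \<otimes> g \<otimes> d) \<otimes> inv d = \<one>" using assms(2) by simp
    then show "g = \<one>" using g assms(2) by (simp add: m_assoc cancel_inv)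
  qed (use assms(2) in simp)
  then show ?thesis using assms g by (auto simp: le_def m_assoc)
qed

end

section \<open>The Prieto and Hucha properties in terms of finite step sets\<close>

lemma Prieto_step_rel:
  assumes "group K" "Prieto K" and Q: "positive_cone K Q"
  obtains D where "finite D" "D \<subseteq> carrier K" "\<forall>x\<in>Q. \<forall>y\<in>Q. (x, y) \<in> (step_rel K D Q)\<^sup>*"
proof -
  interpret group K by fact
  obtain Sg where Sg: "gen_set K Sg" "coarsely_connected K Sg Q"
    using assms Q by (auto simp: Prieto_def)
  then obtain r where r: "\<And>a b. a \<in> Q \<Longrightarrow> b \<in> Q \<Longrightarrow> \<exists>ps. r_path K Sg r ps \<and> hd ps = a \<and> last ps = b \<and> set ps \<subseteq> Q"
    unfolding coarsely_connected_def by blast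
  have "(x, y) \<in> (step_rel K {g \<in> carrier K. real (word_len K Sg g) \<le> r} Q)\<^sup>*"
    if xy: "x \<in> Q" "y \<in> Q" for x y
  proof -
    obtain ps where ps: "r_path K Sg r ps" "hd ps = x" "last ps = y" "set ps \<subseteq> Q"
      using r[OF xy] by blast
    show ?thesis using r_path_step_rel[OF ps(1,4)] ps(2,3) by simp
  qed
  then show thesis
    using that[OF finite_word_ball[OF Sg(1), of r]] by simp
qed

text \<open>The identity is attached to the cone by adding one positive element to the steps. The
  cone is empty only for the trivial group.\<close>

lemma Prieto_step_rel_one:
  assumes "group K" "Prieto K" "positive_cone K Q"
  shows "\<exists>D. finite D \<and> D \<subseteq> carrier K \<and> (\<forall>q\<in>Q. (\<one>\<^bsub>K\<^esub>, q) \<in> (step_rel K D (insert \<one>\<^bsub>K\<^esub> Q))\<^sup>*)"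
proof (cases "Q = {}")
  case False
  interpret group K by fact
  obtain D where D: "finite D" "D \<subseteq> carrier K" "\<forall>x\<in>Q. \<forall>y\<in>Q. (x, y) \<in> (step_rel K D Q)\<^sup>*"
    using Prieto_step_rel[OF assms] .
  obtain p where p: "p \<in> Q" "p \<in> carrier K" using False positive_coneD(1)[OF assms(3)] by blast
  have "(\<one>\<^bsub>K\<^esub>, q) \<in> (step_rel K (insert p D) (insert \<one>\<^bsub>K\<^esub> Q))\<^sup>*" if q: "q \<in> Q" for q
  proof -
    have "(\<one>\<^bsub>K\<^esub>, p) \<in> step_rel K (insert p D) (insert \<one>\<^bsub>K\<^esub> Q)" using p by (simp add: step_rel_def)
    moreover have "(p, q) \<in> (step_rel K (insert p D) (insert \<one>\<^bsub>K\<^esub> Q))\<^sup>*"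
    proof (rule subsetD[OF rtrancl_mono[OF step_rel_mono]])
      show "(p, q) \<in> (step_rel K D Q)\<^sup>*" using D(3) p(1) q by simp
    qed auto
    ultimately show ?thesis by (rule converse_rtrancl_into_rtrancl)
  qed
  then show ?thesis using D p by (intro exI[of _ "insert p D"]) simp
qed (intro exI[of _ "{}"], simp)

lemma negative_iff:
  assumes "group K" "positive_cone K P" "g \<in> carrier K"
  shows "g \<in> m_inv K ` P \<longleftrightarrow> g \<notin> insert \<one>\<^bsub>K\<^esub> P"
  using assms unfolding positive_cone_def by blast

text \<open>A swamp consists of negative elements, so a coarse path inside the cone with the
  identity cannot meet it and therefore cannot join the two cosets.\<close>

lemma Hucha_step_rel:
  assumes "group K" "Hucha K {L}" "positive_cone K P" "finite D" "D \<subseteq> carrier K"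
  shows "\<exists>g1\<in>carrier K. \<exists>g2\<in>carrier K. \<forall>x\<in>g1 <#\<^bsub>K\<^esub> L. \<forall>y\<in>g2 <#\<^bsub>K\<^esub> L.
    x \<in> insert \<one>\<^bsub>K\<^esub> P \<longrightarrow> (x, y) \<notin> (step_rel K D (insert \<one>\<^bsub>K\<^esub> P))\<^sup>*"
proof -
  interpret group K by fact
  obtain Sg where Sg: "\<And>r. r > 0 \<Longrightarrow> \<exists>S. negative_swamp K Sg P L r S"
    using assms by (auto simp: Hucha_def)
  obtain r where r: "r > 0" "\<And>A x y. A \<subseteq> carrier K \<Longrightarrow> x \<in> A \<Longrightarrow> (x, y) \<in> (step_rel K D A)\<^sup>* \<Longrightarrow>
      \<exists>ps. r_path K Sg r ps \<and> hd ps = x \<and> last ps = y \<and> set ps \<subseteq> A"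
    using step_rel_r_path[OF assms(4,5)] by blast
  obtain S where "negative_swamp K Sg P L r S" using Sg r(1) by blast
  then obtain g1 g2 where S: "S \<subseteq> m_inv K ` P" and g: "g1 \<in> carrier K" "g2 \<in> carrier K"
    and dis: "r_disconnects K Sg r S (g1 <#\<^bsub>K\<^esub> L) (g2 <#\<^bsub>K\<^esub> L)"
    unfolding negative_swamp_def by blast
  have sub: "insert \<one>\<^bsub>K\<^esub> P \<subseteq> carrier K" using positive_coneD(1)[OF assms(3)] by simp
  have "(x, y) \<notin> (step_rel K D (insert \<one>\<^bsub>K\<^esub> P))\<^sup>*"
    if xy: "x \<in> g1 <#\<^bsub>K\<^esub> L" "y \<in> g2 <#\<^bsub>K\<^esub> L" "x \<in> insert \<one>\<^bsub>K\<^esub> P" for x y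
  proof
    assume "(x, y) \<in> (step_rel K D (insert \<one>\<^bsub>K\<^esub> P))\<^sup>*"
    then obtain ps where ps: "r_path K Sg r ps" "hd ps = x" "last ps = y" "set ps \<subseteq> insert \<one>\<^bsub>K\<^esub> P"
      using r(2)[OF sub xy(3)] by blast
    then have "set ps \<inter> S \<noteq> {}" using dis xy unfolding r_disconnects_def by blast
    then show False using ps(4) S sub negative_iff[OF assms(1,3)] by blast
  qed
  then show ?thesis using g by blast
qed

section \<open>Separating half-trees by negative elements\<close>

lemma (in group) step_rel_diff:
  assumes "(x, y) \<in> step_rel G D A" "A \<subseteq> carrier G"
  shows "x \<in> A" "y \<in> A" "inv x \<otimes> y \<in> D \<union> m_inv G ` D" "inv y \<otimes> x \<in> D \<union> m_inv G ` D"
proof -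
  show xy: "x \<in> A" "y \<in> A" using assms by (auto simp: step_rel_def)
  have i: "inv (inv x \<otimes> y) = inv y \<otimes> x" "inv (inv y \<otimes> x) = inv x \<otimes> y"
    using xy assms(2) by (auto simp: inv_mult_group subset_iff)
  have "inv x \<otimes> y \<in> D \<or> inv y \<otimes> x \<in> D" using assms(1) by (simp add: step_rel_def)
  then show "inv x \<otimes> y \<in> D \<union> m_inv G ` D" "inv y \<otimes> x \<in> D \<union> m_inv G ` D"
    using i by (metis UnI1 UnI2 image_eqI)+
qed

lemma (in tree_acting_group) stabilizer_subgroup:
  assumes "x \<in> V" shows "subgroup (vstab G \<phi> x) G"
  unfolding vstab_def
proof (rule subgroupI)
  show "{g \<in> carrier G. \<phi> g x = x} \<noteq> {}" using act_one[OF assms] one_closed by blast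
  fix g assume g: "g \<in> {g \<in> carrier G. \<phi> g x = x}"
  then show "inv g \<in> {g \<in> carrier G. \<phi> g x = x}" using act_inv1[of g x] assms by auto
  fix h assume "h \<in> {g \<in> carrier G. \<phi> g x = x}"
  then show "g \<otimes> h \<in> {g \<in> carrier G. \<phi> g x = x}" using g act_mult[of g h x] assms by auto
qed auto

text \<open>Without inversions, preserving the pair means fixing both ends.\<close>

lemma (in tree_acting_group) estab_edge:
  assumes "Adj x y" shows "estab G \<phi> {x, y} = vstab G \<phi> x \<inter> vstab G \<phi> y"
  using no_flip[OF _ assms] by (auto simp: estab_def vstab_def doubleton_eq_iff)

text \<open>The normalisation at \<open>w0\<close> serves the case where \<open>K\<close> is the
  stabilizer of \<open>v\<close>: the orbit of \<open>w0\<close> then corresponds to the cosets of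
  the edge group of \<open>w0\<close>.\<close>

lemma (in tree_acting_group) orbit_representatives:
  assumes K: "subgroup K G" and w0: "w0 \<in> V"
  shows "\<exists>\<rho>. \<rho> w0 = w0 \<and> (\<forall>w\<in>V. \<forall>g\<in>K. \<rho> (\<phi> g w) = \<rho> w) \<and>
    (\<forall>w\<in>V. \<rho> w \<in> V) \<and> (\<forall>w\<in>V. \<exists>g\<in>K. \<phi> g (\<rho> w) = w)"
proof -
  define Orb where "Orb w = {\<phi> g w | g. g \<in> K}" for w
  define rep where "rep C = (if w0 \<in> C then w0 else SOME u. u \<in> C)" for C
  note KG = subgroup.mem_carrier[OF K]
  have self: "w \<in> Orb w" if "w \<in> V" for w
    using act_one[OF that] subgroup.one_closed[OF K] unfolding Orb_def by (metis (mono_tags, lifting) mem_Collect_eq)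
  have inv: "Orb (\<phi> g w) = Orb w" if w: "w \<in> V" and g: "g \<in> K" for w g
  proof
    show "Orb (\<phi> g w) \<subseteq> Orb w"
    proof
      fix z assume "z \<in> Orb (\<phi> g w)"
      then obtain h where "h \<in> K" "z = \<phi> h (\<phi> g w)" by (auto simp: Orb_def)
      then have "z = \<phi> (h \<otimes> g) w" "h \<otimes> g \<in> K"
        using act_mult[of h g w] KG g w subgroup.m_closed[OF K] by auto
      then show "z \<in> Orb w" by (auto simp: Orb_def)
    qed
    show "Orb w \<subseteq> Orb (\<phi> g w)"
    proof
      fix z assume "z \<in> Orb w"
      then obtain h where h: "h \<in> K" "z = \<phi> h w" by (auto simp: Orb_def)
      then have "z = \<phi> (h \<otimes> inv g) (\<phi> g w)" "h \<otimes> inv g \<in> K"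
        using act_mult[of h "inv g" "\<phi> g w"] act_inv1[of g w] act_closed KG[OF g] KG[OF h(1)] g w
          subgroup.m_closed[OF K] subgroup.m_inv_closed[OF K] by auto
      then show "z \<in> Orb (\<phi> g w)" by (auto simp: Orb_def)
    qed
  qed
  have "rep (Orb w) \<in> V \<and> (\<exists>g\<in>K. \<phi> g (rep (Orb w)) = w)" if w: "w \<in> V" for w
  proof -
    have "rep (Orb w) \<in> Orb w" using self[OF w] by (auto simp: rep_def intro: someI)
    then obtain g where g: "g \<in> K" "rep (Orb w) = \<phi> g w" by (auto simp: Orb_def)
    then have "\<phi> (inv g) (rep (Orb w)) = w" using act_inv1[OF KG w] by simp
    then show ?thesis using subgroup.m_inv_closed[OF K g(1)] g act_closed[OF KG w] by auto
  qed
  moreover have "rep (Orb w0) = w0" using self[OF w0] by (simp add: rep_def)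
  ultimately show ?thesis using inv by (intro exI[of _ "\<lambda>w. rep (Orb w)"]) simp
qed

locale ordered_tree_action = general_tree_action G V Adj \<phi> + left_ordered_group G P
  for G :: "('g, 'b) monoid_scheme" (structure) and V :: "'v set" and Adj and \<phi> and P +
  fixes v :: 'v
  assumes v: "v \<in> V"
begin

lemma positive_exists: "\<exists>p. p \<in> P"
proof -
  obtain g where g: "g \<in> carrier G" "\<phi> g v \<noteq> v" using general v by (auto simp: general_type_def)
  then have "g \<noteq> \<one>" using act_one[OF v] by blast
  then show ?thesis using positive_coneD(4)[OF cone g(1)] by blast
qed

lemma strictly_above:
  assumes "m \<in> carrier G" obtains d where "d \<in> carrier G" "m \<sqsubseteq> d" "\<not> d \<sqsubseteq> m"
proof -
  obtain p where p: "p \<in> P" using positive_exists by blast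
  note pG = P_closed[OF p]
  have "m \<sqsubseteq> m \<otimes> p" using p pG assms by (simp add: le_def cancel_inv)
  moreover have "\<not> m \<otimes> p \<sqsubseteq> m"
  proof
    assume "m \<otimes> p \<sqsubseteq> m"
    then have "m \<otimes> p = m" using le_antisym \<open>m \<sqsubseteq> m \<otimes> p\<close> assms pG by blast
    then have "p = \<one>" using cancel_inv(1)[OF assms pG] assms by simp
    then show False using p positive_coneD(3)[OF cone] by blast
  qed
  ultimately show thesis using that[of "m \<otimes> p"] assms pG by simp
qed

text \<open>Take \<open>u\<close> above both \<open>f\<close> and \<open>inv g \<otimes> f\<close>,
  where \<open>g\<close> moves the complement into \<open>B a b\<close>. If \<open>u\<close> is
  located on the wrong side, \<open>g \<otimes> u\<close> is on the right one and still above
  \<open>f\<close>.\<close>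

lemma halftree_unbounded:
  assumes ab: "Adj a b" and f: "f \<in> carrier G"
  shows "\<exists>u\<in>carrier G. \<phi> u v \<in> B a b \<and> inv f \<otimes> u \<in> P"
proof -
  obtain g where g: "g \<in> carrier G" "\<phi> g ` B b a \<subseteq> B a b" using skewer[OF ab adj_V(3)[OF ab]] .
  obtain m where m: "m \<in> carrier G" "f \<sqsubseteq> m" "inv g \<otimes> f \<sqsubseteq> m"
    using finite_upper_bound[of "{f, inv g \<otimes> f}"] f g by auto
  obtain u where u: "u \<in> carrier G" "m \<sqsubseteq> u" "\<not> u \<sqsubseteq> m" using strictly_above[OF m(1)] .
  have ok: "inv f \<otimes> x \<in> P" if x: "x \<in> carrier G" "f \<sqsubseteq> x" "\<not> x \<sqsubseteq> f" for x
  proof -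
    have "inv f \<otimes> x \<noteq> \<one>"
    proof
      assume "inv f \<otimes> x = \<one>"
      then have "x = f" using cancel_inv(2)[OF f x(1)] f by simp
      then show False using x le_refl by blast
    qed
    then show ?thesis using x(2) unfolding le_def by blast
  qed
  have fu: "f \<sqsubseteq> u" "\<not> u \<sqsubseteq> f" using le_trans[of f m u] le_trans[of u f m] f m u by blast+
  have gf: "inv g \<otimes> f \<in> carrier G" using f g by simp
  have "inv g \<otimes> f \<sqsubseteq> u" "\<not> u \<sqsubseteq> inv g \<otimes> f"
    using le_trans[of "inv g \<otimes> f" m u] le_trans[of u "inv g \<otimes> f" m] gf m u by blast+
  then have gu: "f \<sqsubseteq> g \<otimes> u" "\<not> g \<otimes> u \<sqsubseteq> f"
    using le_mult[OF g(1) gf u(1)] le_mult[OF g(1) u(1) gf] f g by (simp_all add: cancel_inv)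
  show ?thesis
  proof (cases "\<phi> u v \<in> B a b")
    case True
    then show ?thesis using ok[OF u(1) fu] u by blast
  next
    case False
    then have "\<phi> u v \<in> B b a" using halftree_cover[OF ab act_closed[OF u(1) v]] by blast
    then have "\<phi> (g \<otimes> u) v \<in> B a b" using g u v act_mult[of g u v] by auto
    then show ?thesis using ok[OF _ gu] g u by blast
  qed
qed

section \<open>Coarse paths crossing an edge\<close>

definition upset :: "'g \<Rightarrow> 'g set" where
  "upset d = {x \<in> carrier G. d \<sqsubseteq> x}"

lemma upset_carrier: "upset d \<subseteq> carrier G"
  by (auto simp: upset_def)

text \<open>Up to translation, these are all the edges that a single step can cross: by
  \<open>crossings_mem\<close>, an edge crossed by a step from \<open>q\<close> falls into this set
  after pulling back by \<open>inv q\<close>.\<close>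

definition crossings :: "'g set \<Rightarrow> ('v \<times> 'v) set" where
  "crossings D = (\<Union>s\<in>D \<union> m_inv G ` D. sep v (\<phi> s v) \<union> sep (\<phi> s v) v)"

lemma finite_crossings: "finite D \<Longrightarrow> D \<subseteq> carrier G \<Longrightarrow> finite (crossings D)"
  unfolding crossings_def using finite_sep[OF v act_closed[OF _ v]] finite_sep[OF act_closed[OF _ v] v]
  by (intro finite_UN_I finite_UnI) auto

lemma crossings_mem:
  assumes D: "D \<subseteq> carrier G" and q: "q \<in> carrier G" "q' \<in> carrier G" "inv q \<otimes> q' \<in> D \<union> m_inv G ` D"
    and ab: "Adj a b" and ne: "(\<phi> q v \<in> B a b) \<noteq> (\<phi> q' v \<in> B a b)"
  shows "(\<phi> (inv q) a, \<phi> (inv q) b) \<in> crossings D"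
proof -
  define s where "s = inv q \<otimes> q'"
  have s: "s \<in> carrier G" "q' = q \<otimes> s" using q by (auto simp: s_def cancel_inv)
  then have q': "\<phi> q' v = \<phi> q (\<phi> s v)" using act_mult[OF q(1) s(1) v] by simp
  note sv = act_closed[OF s(1) v]
  have "(a, b) \<in> sep (\<phi> q v) (\<phi> q (\<phi> s v)) \<or> (a, b) \<in> sep (\<phi> q (\<phi> s v)) (\<phi> q v)"
    using ne ab by (auto simp: q' sep_def)
  then have "(\<phi> (inv q) a, \<phi> (inv q) b) \<in> sep v (\<phi> s v) \<union> sep (\<phi> s v) v"
    using sep_act[OF q(1) v sv] sep_act[OF q(1) sv v] by blast
  then show ?thesis using q(3) unfolding crossings_def s_def by blast
qed

text \<open>The lower bound \<open>d\<close> plays the part of the identity. Left translation by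
  \<open>inv d\<close> later turns elements above \<open>d\<close> into nonnegative ones.\<close>

definition separated :: "'g set \<Rightarrow> 'g \<Rightarrow> 'v set \<Rightarrow> 'v set \<Rightarrow> bool" where
  "separated D d Y Z \<longleftrightarrow> (\<forall>q q'. (q, q') \<in> (step_rel G D (upset d))\<^sup>* \<longrightarrow> q \<in> upset d \<longrightarrow>
     \<phi> q v \<in> Y \<longrightarrow> \<phi> q' v \<notin> Z)"

text \<open>The elements that pull the edge back to the same pair \<open>e\<close> lie in a single
  set \<open>H k\<close>, where \<open>H\<close> fixes the edge. As finitely many pairs occur at
  crossings, boundedness of these sets gives one bound for all crossing points, and \<open>d\<close>
  is taken strictly above it.\<close>

lemma separated_bounded:
  assumes ab: "Adj a b" and D: "finite D" "D \<subseteq> carrier G"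
    and bounded: "\<And>k. k \<in> carrier G \<Longrightarrow> \<exists>m\<in>carrier G. \<forall>h\<in>vstab G \<phi> a \<inter> vstab G \<phi> b. h \<otimes> k \<sqsubseteq> m"
  shows "\<exists>d\<in>carrier G. separated D d (B b a) (B a b)"
proof -
  note aV = adj_V(1)[OF ab] and bV = adj_V(2)[OF ab]
  have "\<exists>m\<in>carrier G. \<forall>q\<in>carrier G. (\<phi> (inv q) a, \<phi> (inv q) b) = e \<longrightarrow> q \<sqsubseteq> m" for e
  proof (cases "\<exists>q\<in>carrier G. (\<phi> (inv q) a, \<phi> (inv q) b) = e")
    case True
    then obtain k where k: "k \<in> carrier G" "(\<phi> (inv k) a, \<phi> (inv k) b) = e" by blast
    obtain m where m: "m \<in> carrier G" "\<forall>h\<in>vstab G \<phi> a \<inter> vstab G \<phi> b. h \<otimes> k \<sqsubseteq> m" using bounded[OF k(1)] by blast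
    have "q \<sqsubseteq> m" if q: "q \<in> carrier G" "(\<phi> (inv q) a, \<phi> (inv q) b) = e" for q
    proof -
      have "\<phi> (q \<otimes> inv k) a = a" "\<phi> (q \<otimes> inv k) b = b"
        using q k aV bV act_mult[of q "inv k"] act_inv2[of q] by auto
      then have "(q \<otimes> inv k) \<otimes> k \<sqsubseteq> m" using m(2) q(1) k(1) by (simp add: vstab_def)
      then show ?thesis using q k by (simp add: m_assoc)
    qed
    then show ?thesis using m(1) by blast
  qed (use one_closed in blast)
  then obtain f where f: "\<And>e. f e \<in> carrier G"
    "\<And>e q. q \<in> carrier G \<Longrightarrow> (\<phi> (inv q) a, \<phi> (inv q) b) = e \<Longrightarrow> q \<sqsubseteq> f e" by metis
  obtain M where M: "M \<in> carrier G" "\<forall>x\<in>f ` crossings D. x \<sqsubseteq> M"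
    using finite_upper_bound[of "f ` crossings D"] finite_crossings[OF D] f(1) by blast
  obtain d where d: "d \<in> carrier G" "M \<sqsubseteq> d" "\<not> d \<sqsubseteq> M" using strictly_above[OF M(1)] .
  have "separated D d (B b a) (B a b)" unfolding separated_def
  proof (intro allI impI)
    fix q q' assume q: "(q, q') \<in> (step_rel G D (upset d))\<^sup>*" "q \<in> upset d" "\<phi> q v \<in> B b a"
    show "\<phi> q' v \<notin> B a b"
      using q(1)
    proof (induction rule: rtrancl_induct)
      case base
      then show ?case using q(3) halftree_disjoint[OF ab] by blast
    next
      case (step y z)
      note yz = step_rel_diff[OF step(2) upset_carrier]
      have G: "y \<in> carrier G" "z \<in> carrier G" "d \<sqsubseteq> y" using yz by (auto simp: upset_def)
      show ?case
      proof
        assume "\<phi> z v \<in> B a b"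
        then have "(\<phi> (inv y) a, \<phi> (inv y) b) \<in> crossings D"
          using crossings_mem[OF D(2) G(1,2) yz(3) ab] step.IH by blast
        then have "f (\<phi> (inv y) a, \<phi> (inv y) b) \<sqsubseteq> M" using M(2) by blast
        then have "y \<sqsubseteq> M" using f(2)[OF G(1) refl] le_trans[OF G(1) f(1) M(1)] by blast
        then show False using le_trans[OF d(1) G(1) M(1)] G d by blast
      qed
    qed
  qed
  then show ?thesis using d(1) by blast
qed

lemma edge_stabilizer_subgroup:
  assumes "Adj x y" shows "subgroup (vstab G \<phi> x \<inter> vstab G \<phi> y) G"
  using subgroups_Inter_pair[OF stabilizer_subgroup stabilizer_subgroup] adj_V[OF assms] by blast

section \<open>Projection to the vertex group in the cofinal case\<close>

text \<open>The element \<open>\<kappa> e\<close> moves a pulled-back edge to its standard position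
  \<open>(v, \<rho> w)\<close>. It can depend on \<open>e\<close> alone, because two descriptions of
  \<open>e\<close> by \<open>q\<close> and \<open>w\<close> differ by an element fixing
  \<open>v\<close>, which \<open>\<rho>\<close> ignores. Finitely many pairs thus need finitely many
  correcting factors.\<close>

lemma normalizing_elements:
  assumes \<rho>: "\<And>w g. w \<in> V \<Longrightarrow> g \<in> vstab G \<phi> v \<Longrightarrow> \<rho> (\<phi> g w) = \<rho> w"
      "\<And>w. w \<in> V \<Longrightarrow> \<exists>g\<in>vstab G \<phi> v. \<phi> g (\<rho> w) = w" "\<And>w. w \<in> V \<Longrightarrow> \<rho> w \<in> V"
  shows "\<exists>\<kappa>. \<forall>e. \<kappa> e \<in> carrier G \<and> (\<forall>q w. q \<in> carrier G \<longrightarrow> w \<in> V \<longrightarrow>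
    (\<phi> (inv q) v, \<phi> (inv q) w) = e \<longrightarrow> \<phi> (\<kappa> e) (\<phi> (inv q) v) = v \<and> \<phi> (\<kappa> e) (\<phi> (inv q) w) = \<rho> w)"
proof -
  have "\<exists>k. k \<in> carrier G \<and> (\<forall>q w. q \<in> carrier G \<longrightarrow> w \<in> V \<longrightarrow>
    (\<phi> (inv q) v, \<phi> (inv q) w) = e \<longrightarrow> \<phi> k (\<phi> (inv q) v) = v \<and> \<phi> k (\<phi> (inv q) w) = \<rho> w)" for e
  proof (cases "\<exists>q w. q \<in> carrier G \<and> w \<in> V \<and> (\<phi> (inv q) v, \<phi> (inv q) w) = e")
    case True
    then obtain p u where p: "p \<in> carrier G" "u \<in> V" "(\<phi> (inv p) v, \<phi> (inv p) u) = e" by blast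
    obtain g where g: "g \<in> vstab G \<phi> v" "\<phi> g (\<rho> u) = u" using \<rho>(2)[OF p(2)] by blast
    have gG: "g \<in> carrier G" "\<phi> g v = v" using g(1) by (auto simp: vstab_def)
    have gv: "\<phi> (inv g) v = v" using act_inv1[OF gG(1) v] gG(2) by simp
    have "\<phi> (inv g \<otimes> p) (\<phi> (inv q) v) = v \<and> \<phi> (inv g \<otimes> p) (\<phi> (inv q) w) = \<rho> w"
      if q: "q \<in> carrier G" "w \<in> V" "(\<phi> (inv q) v, \<phi> (inv q) w) = e" for q w
    proof -
      have e: "\<phi> (inv q) v = \<phi> (inv p) v" "\<phi> (inv q) w = \<phi> (inv p) u" using p q by auto
      define t where "t = q \<otimes> inv p"
      have t: "t \<in> carrier G" using p q by (simp add: t_def)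
      have "\<phi> t v = v" using act_mult[of q "inv p" v] act_inv2[of q v] q p v e by (simp add: t_def)
      then have tv: "t \<in> vstab G \<phi> v" using t by (simp add: vstab_def)
      have "\<phi> t u = w" using act_mult[of q "inv p" u] act_inv2[of q w] q p e by (simp add: t_def)
      then have "\<rho> w = \<rho> u" using \<rho>(1)[OF p(2) tv] by simp
      have "\<phi> (inv g) u = \<rho> u" using act_inv1[OF gG(1) \<rho>(3)[OF p(2)]] g(2) by simp
      have "\<phi> (inv g \<otimes> p) (\<phi> (inv p) x) = \<phi> (inv g) x" if "x \<in> V" for x
        using act_mult[of "inv g" p "\<phi> (inv p) x"] act_inv2[of p x] act_closed[of "inv p" x] gG p that by simp
      then show ?thesis using e gv v p(2) \<open>\<phi> (inv g) u = \<rho> u\<close> \<open>\<rho> w = \<rho> u\<close> by simp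
    qed
    then show ?thesis using gG p by (intro exI[of _ "inv g \<otimes> p"]) simp
  next
    case False
    then show ?thesis using one_closed by blast
  qed
  then show ?thesis by (rule choice[OF allI])
qed

text \<open>The branches arise from two cosets of \<open>H\<close> that the Hucha property keeps
  apart, by sending \<open>g H\<close> to \<open>\<phi> g w0\<close>. A coarse path above
  \<open>d\<close> between these branches would be shadowed by a coarse path between the cosets
  inside the nonnegative part of the vertex group.\<close>

lemma separated_cofinal:
  assumes w0: "Adj v w0" and D: "finite D" "D \<subseteq> carrier G" and d: "d \<in> carrier G"
    and cofinal: "\<And>m. m \<in> carrier G \<Longrightarrow> \<exists>h\<in>vstab G \<phi> v \<inter> vstab G \<phi> w0. m \<sqsubseteq> h \<otimes> d"
    and Hucha: "Hucha (G\<lparr>carrier := vstab G \<phi> v\<rparr>) {vstab G \<phi> v \<inter> vstab G \<phi> w0}"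
    and Prieto: "\<And>w. Adj v w \<Longrightarrow> Prieto (G\<lparr>carrier := vstab G \<phi> v \<inter> vstab G \<phi> w\<rparr>)"
  shows "\<exists>w1 w2. Adj v w1 \<and> Adj v w2 \<and> separated D d (B v w1) (B v w2)"
proof -
  define K where "K = vstab G \<phi> v"
  define E where "E w = vstab G \<phi> v \<inter> vstab G \<phi> w" for w
  define H where "H = E w0"
  have K: "subgroup K G" unfolding K_def by (rule stabilizer_subgroup[OF v])
  have E: "subgroup (E w) G" if "Adj v w" for w unfolding E_def by (rule edge_stabilizer_subgroup[OF that])
  note KG = subgroup.mem_carrier[OF K] and Kinv = subgroup.m_inv_closed[OF K] and Kmult = subgroup.m_closed[OF K]
  have Kv: "g \<in> K \<longleftrightarrow> g \<in> carrier G \<and> \<phi> g v = v" for g by (auto simp: K_def vstab_def)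
  have E_iff: "g \<in> E w \<longleftrightarrow> g \<in> K \<and> \<phi> g w = w" for g w by (auto simp: E_def K_def vstab_def)
  have EK: "E w \<subseteq> K" for w by (auto simp: K_def E_def)
  note w0V = adj_V(2)[OF w0]
  obtain \<rho> where \<rho>: "\<rho> w0 = w0" "\<And>w g. w \<in> V \<Longrightarrow> g \<in> K \<Longrightarrow> \<rho> (\<phi> g w) = \<rho> w"
    "\<And>w. w \<in> V \<Longrightarrow> \<rho> w \<in> V" "\<And>w. w \<in> V \<Longrightarrow> \<exists>g\<in>K. \<phi> g (\<rho> w) = w"
    using orbit_representatives[OF K w0V] by blast
  obtain \<kappa> where "\<forall>e. \<kappa> e \<in> carrier G \<and> (\<forall>q w. q \<in> carrier G \<longrightarrow> w \<in> V \<longrightarrow>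
    (\<phi> (inv q) v, \<phi> (inv q) w) = e \<longrightarrow> \<phi> (\<kappa> e) (\<phi> (inv q) v) = v \<and> \<phi> (\<kappa> e) (\<phi> (inv q) w) = \<rho> w)"
    using normalizing_elements[OF \<rho>(2)[unfolded K_def] \<rho>(4)[unfolded K_def] \<rho>(3)] ..
  then have \<kappa>: "\<And>e. \<kappa> e \<in> carrier G"
    "\<And>q w. q \<in> carrier G \<Longrightarrow> w \<in> V \<Longrightarrow> \<phi> (\<kappa> (\<phi> (inv q) v, \<phi> (inv q) w)) (\<phi> (inv q) v) = v"
    "\<And>q w. q \<in> carrier G \<Longrightarrow> w \<in> V \<Longrightarrow> \<phi> (\<kappa> (\<phi> (inv q) v, \<phi> (inv q) w)) (\<phi> (inv q) w) = \<rho> w"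
    by (simp_all del: split_paired_All)
  define C where "C = crossings D"
  have finC: "finite C" unfolding C_def by (rule finite_crossings[OF D])
  \<comment> \<open>The factors that correct crossing points; \<open>\<one>\<close> serves elements
    located at \<open>v\<close> itself.\<close>
  define KK where "KK = insert \<one> (\<kappa> ` C)"
  have KK: "finite KK" "KK \<subseteq> carrier G" using finC \<kappa>(1) by (auto simp: KK_def)
  \<comment> \<open>Representatives of the branches that a step can enter or leave. Their finiteness
    keeps the union of the step sets of their edge groups finite.\<close>
  define W where "W = {\<rho> w | w q. Adj v w \<and> q \<in> carrier G \<and> (\<phi> (inv q) v, \<phi> (inv q) w) \<in> C}"
  have "W \<subseteq> (\<lambda>e. \<phi> (\<kappa> e) (snd e)) ` C"
  proof
    fix u assume "u \<in> W"
    then obtain w q where w: "Adj v w" "q \<in> carrier G" "(\<phi> (inv q) v, \<phi> (inv q) w) \<in> C" "u = \<rho> w"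
      by (auto simp: W_def)
    then show "u \<in> (\<lambda>e. \<phi> (\<kappa> e) (snd e)) ` C" using \<kappa>(3)[OF w(2) adj_V(2)[OF w(1)]]
      by (intro image_eqI[of _ _ "(\<phi> (inv q) v, \<phi> (inv q) w)"]) auto
  qed
  then have finW: "finite W" using finC finite_subset by blast
  have adj_rep: "Adj v (\<rho> w)" if w: "Adj v w" for w
  proof -
    obtain g where g: "g \<in> K" "\<phi> g (\<rho> w) = w" using \<rho>(4) adj_V(2)[OF w] by blast
    then have "Adj (\<phi> (inv g) v) (\<phi> (inv g) w)" using adj_act[OF _ w, of "inv g"] KG Kinv by blast
    moreover have "\<phi> (inv g) w = \<rho> w" using act_inv1[OF KG[OF g(1)] \<rho>(3)[OF adj_V(2)[OF w]]] g(2) by simp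
    moreover have "\<phi> (inv g) v = v" using Kinv[OF g(1)] Kv by blast
    ultimately show ?thesis by simp
  qed
  obtain c where c: "c \<in> H" "\<And>k. k \<in> KK \<Longrightarrow> k \<sqsubseteq> c \<otimes> d"
  proof -
    obtain m where m: "m \<in> carrier G" "\<forall>k\<in>KK. k \<sqsubseteq> m" using finite_upper_bound[OF KK] by blast
    obtain h where h: "h \<in> H" "m \<sqsubseteq> h \<otimes> d" using cofinal[OF m(1)] by (auto simp: H_def E_def)
    have hG: "h \<in> carrier G" using h(1) KG EK unfolding H_def by blast
    have "k \<sqsubseteq> h \<otimes> d" if k: "k \<in> KK" for k
    proof (rule le_trans[OF _ m(1)])
      show "k \<in> carrier G" using k KK by blast
    qed (use k m h hG d in auto)
    then show thesis using that[OF h(1)] by blast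
  qed
  have cK: "c \<in> K" using c(1) EK unfolding H_def by blast
  note cG = KG[OF cK]
  have cd: "c \<otimes> d \<in> carrier G" using cG d by simp
  define A where "A = insert \<one> {g \<in> K. inv d \<otimes> g \<otimes> d \<in> P}"
  have AK: "A \<subseteq> K" using subgroup.one_closed[OF K] by (auto simp: A_def)
  have AG: "A \<subseteq> carrier G" using AK KG by blast
  have A_iff: "x \<in> A \<longleftrightarrow> d \<sqsubseteq> x \<otimes> d" if "x \<in> K" for x
    unfolding A_def by (rule subgroup_cone_iff[OF K d that])
  have Ac_iff: "x \<otimes> c \<in> A \<longleftrightarrow> d \<sqsubseteq> x \<otimes> (c \<otimes> d)" if "x \<in> K" for x
    using A_iff[OF Kmult[OF that cK]] KG[OF that] cG d by (simp add: m_assoc)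
  \<comment> \<open>The base point is \<open>c \<otimes> d\<close>: if \<open>x \<otimes> c\<close>
    lies in \<open>A\<close> and \<open>q\<close> is nonnegative for this cone, then
    \<open>x \<otimes> q \<otimes> (c \<otimes> d)\<close> is above
    \<open>x \<otimes> (c \<otimes> d)\<close>, hence above \<open>d\<close>, and
    \<open>x \<otimes> q \<otimes> c\<close> lies in \<open>A\<close> as well.\<close>
  define Q where "Q w = {g \<in> E w. inv (c \<otimes> d) \<otimes> g \<otimes> (c \<otimes> d) \<in> P}" for w
  have Qcone: "positive_cone (G\<lparr>carrier := E w\<rparr>) (Q w)" if "Adj v w" for w
    unfolding Q_def by (rule subgroup_cone[OF E[OF that] cd])
  have Wadj: "Adj v w" if "w \<in> W" for w using that adj_rep by (auto simp: W_def)
  have "\<exists>D. finite D \<and> D \<subseteq> E w \<and> (\<forall>q\<in>Q w. (\<one>, q) \<in> (step_rel G D (insert \<one> (Q w)))\<^sup>*)" if w: "w \<in> W" for w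
  proof -
    note vw = Wadj[OF w]
    have "insert \<one> (Q w) \<subseteq> E w" using subgroup.one_closed[OF E[OF vw]] by (auto simp: Q_def)
    from step_rel_subgroup[OF E[OF vw] this] show ?thesis
      using Prieto_step_rel_one[OF subgroup.subgroup_is_group[OF E[OF vw] group_axioms] Prieto[OF vw, folded E_def] Qcone[OF vw]]
      by simp
  qed
  then obtain DD where DD: "\<And>w. w \<in> W \<Longrightarrow> finite (DD w)" "\<And>w. w \<in> W \<Longrightarrow> DD w \<subseteq> E w"
    "\<And>w q. w \<in> W \<Longrightarrow> q \<in> Q w \<Longrightarrow> (\<one>, q) \<in> (step_rel G (DD w) (insert \<one> (Q w)))\<^sup>*" by metis
  \<comment> \<open>The elements \<open>x \<otimes> s \<otimes> c\<close> and
    \<open>x \<otimes> t \<otimes> c\<close> differ by the step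
    \<open>inv c \<otimes> (inv s \<otimes> t) \<otimes> c\<close>, hence the conjugation. The
    second part of \<open>DR\<close> collects the differences between the corrected versions of two
    consecutive points of the path.\<close>
  define D1 where "D1 = (\<lambda>s. inv c \<otimes> s \<otimes> c) ` (\<Union>w\<in>W. DD w)"
  define DR where "DR = D1 \<union> ((\<lambda>(k, s, k'). inv c \<otimes> (k \<otimes> s \<otimes> inv k') \<otimes> c) ` (KK \<times> (D \<union> m_inv G ` D) \<times> KK) \<inter> K)"
  have finDR: "finite DR" using DD(1) finW KK D by (auto simp: DR_def D1_def)
  have "D1 \<subseteq> K"
  proof
    fix x assume "x \<in> D1"
    then obtain w s where "w \<in> W" "s \<in> DD w" "x = inv c \<otimes> s \<otimes> c" by (auto simp: D1_def)
    moreover from this have "s \<in> K" using DD(2) EK by blast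
    ultimately show "x \<in> K" using Kmult Kinv cK by blast
  qed
  then have DRK: "DR \<subseteq> K" by (auto simp: DR_def)
  define R where "R = (step_rel G DR A)\<^sup>*"
  obtain g1 g2 where g: "g1 \<in> K" "g2 \<in> K"
    and apart: "\<And>x y. x \<in> g1 <# H \<Longrightarrow> y \<in> g2 <# H \<Longrightarrow> x \<in> A \<Longrightarrow> (x, y) \<notin> R"
  proof -
    have "\<exists>g1\<in>K. \<exists>g2\<in>K. \<forall>x\<in>g1 <# H. \<forall>y\<in>g2 <# H. x \<in> A \<longrightarrow> (x, y) \<notin> (step_rel (G\<lparr>carrier := K\<rparr>) DR A)\<^sup>*"
      using Hucha_step_rel[OF subgroup.subgroup_is_group[OF K group_axioms] Hucha[folded K_def E_def, folded H_def]
          subgroup_cone[OF K d] finDR] DRK by (simp add: A_def l_coset_def)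
    then show thesis using that unfolding step_rel_subgroup[OF K AK] R_def by blast
  qed
  define w1 where "w1 = \<phi> g1 w0"
  define w2 where "w2 = \<phi> g2 w0"
  have adj12: "Adj v w1" "Adj v w2" using adj_act[OF _ w0] g by (force simp: w1_def w2_def Kv)+
  \<comment> \<open>The possible shadows of an excursion into the branch at \<open>w\<close>: part
    of one coset of the edge group of \<open>\<rho> w\<close>, cut down so that right multiplication
    by \<open>c\<close> leads into \<open>A\<close>.\<close>
  define Z where "Z w = {x \<in> K. d \<sqsubseteq> x \<otimes> (c \<otimes> d) \<and> \<phi> x (\<rho> w) = w}" for w
  have Zquot: "inv x \<otimes> y \<in> E (\<rho> w)" if "x \<in> Z w" "y \<in> Z w" "Adj v w" for x y w
  proof -
    have xy: "x \<in> K" "y \<in> K" "\<phi> x (\<rho> w) = w" "\<phi> y (\<rho> w) = w" using that by (auto simp: Z_def)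
    note G = KG[OF xy(1)] KG[OF xy(2)] and r = \<rho>(3)[OF adj_V(2)[OF that(3)]]
    have "inv x \<otimes> y \<in> K" using Kmult[OF Kinv[OF xy(1)] xy(2)] .
    moreover have "\<phi> (inv x \<otimes> y) (\<rho> w) = \<rho> w"
      using act_mult[OF inv_closed[OF G(1)] G(2) r] act_inv1[OF G(1) r] unfolding xy(3,4) by (rule trans)
    ultimately show ?thesis by (simp add: E_iff)
  qed
  have chain: "(x \<otimes> c, x \<otimes> q \<otimes> c) \<in> R"
    if x: "x \<in> Z w" and w: "\<rho> w \<in> W" and q: "(\<one>, q) \<in> (step_rel G (DD (\<rho> w)) (insert \<one> (Q (\<rho> w))))\<^sup>*" for x w q
    using q
  proof (induction rule: rtrancl_induct)
    case base
    have "x \<in> carrier G" using x KG by (auto simp: Z_def)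
    then show ?case by (simp add: R_def)
  next
    case (step y z)
    have xK: "x \<in> K" "d \<sqsubseteq> x \<otimes> (c \<otimes> d)" using x by (auto simp: Z_def)
    note xG = KG[OF xK(1)]
    have sub: "insert \<one> (Q (\<rho> w)) \<subseteq> E (\<rho> w)"
      using subgroup.one_closed[OF E[OF Wadj[OF w]]] by (auto simp: Q_def)
    have mem: "x \<otimes> t \<otimes> c \<in> A \<and> t \<in> K" if t: "t \<in> insert \<one> (Q (\<rho> w))" for t
    proof -
      have tE: "t \<in> E (\<rho> w)" using sub t by blast
      then have tK: "t \<in> K" using EK by blast
      have "c \<otimes> d \<sqsubseteq> t \<otimes> (c \<otimes> d)"
        using subgroup_cone_iff[OF E[OF Wadj[OF w]] cd tE] t unfolding Q_def by simp
      then have "x \<otimes> (c \<otimes> d) \<sqsubseteq> x \<otimes> (t \<otimes> (c \<otimes> d))" using le_mult xG KG[OF tK] cd by simp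
      then have "d \<sqsubseteq> x \<otimes> (t \<otimes> (c \<otimes> d))"
        using le_trans[OF d _ _ xK(2)] xG KG[OF tK] cd by simp
      then show ?thesis using Ac_iff[OF Kmult[OF xK(1) tK]] tK xG KG[OF tK] cd by (simp add: m_assoc)
    qed
    have yz: "y \<in> insert \<one> (Q (\<rho> w))" "z \<in> insert \<one> (Q (\<rho> w))"
      "inv y \<otimes> z \<in> DD (\<rho> w) \<or> inv z \<otimes> y \<in> DD (\<rho> w)" using step(2) by (auto simp: step_rel_def)
    have diff: "inv (x \<otimes> s \<otimes> c) \<otimes> (x \<otimes> t \<otimes> c) = inv c \<otimes> (inv s \<otimes> t) \<otimes> c" if "s \<in> K" "t \<in> K" for s t
      using KG[OF that(1)] KG[OF that(2)] xG cG by (simp add: inv_mult_group m_assoc cancel_inv)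
    have "inv (x \<otimes> y \<otimes> c) \<otimes> (x \<otimes> z \<otimes> c) \<in> DR \<or> inv (x \<otimes> z \<otimes> c) \<otimes> (x \<otimes> y \<otimes> c) \<in> DR"
      using yz(3) w mem[OF yz(1)] mem[OF yz(2)] diff unfolding DR_def D1_def by auto
    then have "(x \<otimes> y \<otimes> c, x \<otimes> z \<otimes> c) \<in> step_rel G DR A"
      using mem[OF yz(1)] mem[OF yz(2)] by (simp add: step_rel_def)
    then show ?case using step.IH unfolding R_def by (rule rtrancl_into_rtrancl[rotated])
  qed
  \<comment> \<open>One of \<open>inv x \<otimes> y\<close> and its inverse is nonnegative for
    \<open>Q\<close>, and \<open>chain\<close> is started at the smaller of the two points. The
    symmetry of the steps covers the other order.\<close>
  have Zconn: "(x \<otimes> c, y \<otimes> c) \<in> R" if x: "x \<in> Z w" and y: "y \<in> Z w" and w: "Adj v w" "\<rho> w \<in> W" for x y w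
  proof -
    have G: "x \<in> carrier G" "y \<in> carrier G" using x y KG by (auto simp: Z_def)
    interpret EG: group "G\<lparr>carrier := E (\<rho> w)\<rparr>"
      using subgroup.subgroup_is_group[OF E[OF Wadj[OF w(2)]] group_axioms] .
    have xy: "inv x \<otimes> y \<in> E (\<rho> w)" by (rule Zquot[OF x y w(1)])
    have i: "inv\<^bsub>G\<lparr>carrier := E (\<rho> w)\<rparr>\<^esub> (inv x \<otimes> y) = inv y \<otimes> x"
      using m_inv_consistent[OF E[OF Wadj[OF w(2)]] xy] G by (simp add: inv_mult_group)
    have "inv x \<otimes> y \<in> Q (\<rho> w) \<or> inv y \<otimes> x \<in> Q (\<rho> w) \<or> inv x \<otimes> y = \<one>"
      using EG.positive_coneD(4)[OF Qcone[OF Wadj[OF w(2)]], of "inv x \<otimes> y"] xy i by simp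
    moreover have "inv x \<otimes> y = \<one> \<Longrightarrow> x = y" using cancel_inv(2)[OF G] G by simp
    moreover have "(x \<otimes> c, y \<otimes> c) \<in> R" if "inv x \<otimes> y \<in> Q (\<rho> w)"
      using chain[OF x w(2) DD(3)[OF w(2) that]] cancel_inv(2)[OF G] by simp
    moreover have "(y \<otimes> c, x \<otimes> c) \<in> R" if "inv y \<otimes> x \<in> Q (\<rho> w)"
      using chain[OF y w(2) DD(3)[OF w(2) that]] cancel_inv(2)[OF G(2,1)] by simp
    moreover have "(x \<otimes> c, x \<otimes> c) \<in> R" by (simp add: R_def)
    ultimately show ?thesis
      using step_rel_rtrancl_sym[of "y \<otimes> c" "x \<otimes> c" G DR A] unfolding R_def by metis
  qed
  have unique: "w = w'" if "Adj v w" "Adj v w'" "z \<in> B v w" "z \<in> B v w'" for w w' z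
    using siblings_disjoint[OF that(1,2)] that(3,4) by blast
  have v_notin: "v \<notin> B v w" if "Adj v w" for w using halftree_sub[OF that] by blast
  text \<open>Where a coarse path changes its branch at \<open>v\<close>, it is within bounded distance of the vertex stabilizer.\<close>
  have anchor: "\<exists>k\<in>KK. q \<otimes> inv k \<in> K \<and> d \<sqsubseteq> q \<otimes> inv k \<otimes> (c \<otimes> d) \<and> (\<phi> q v = v \<longrightarrow> q \<otimes> inv k = q) \<and>
      (\<forall>w. Adj v w \<longrightarrow> \<phi> q v \<in> B v w \<longrightarrow> q \<otimes> inv k \<in> Z w \<and> \<rho> w \<in> W)"
    if q: "q \<in> carrier G" "q' \<in> carrier G" "d \<sqsubseteq> q" "inv q \<otimes> q' \<in> D \<union> m_inv G ` D"
      and change: "\<not> (\<exists>w. Adj v w \<and> \<phi> q v \<in> B v w \<and> \<phi> q' v \<in> B v w)" for q q'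
  proof -
    have above: "d \<sqsubseteq> q \<otimes> inv k \<otimes> (c \<otimes> d)" if k: "k \<in> KK" for k
    proof (rule le_trans[OF d q(1) _ q(3)])
      have kG: "k \<in> carrier G" using k KK by blast
      then show "q \<otimes> inv k \<otimes> (c \<otimes> d) \<in> carrier G" using q cd by simp
      have "q \<otimes> inv k \<otimes> k \<sqsubseteq> q \<otimes> inv k \<otimes> (c \<otimes> d)" using le_mult[of "q \<otimes> inv k" k "c \<otimes> d"] c(2)[OF k] kG cd q by simp
      then show "q \<sqsubseteq> q \<otimes> inv k \<otimes> (c \<otimes> d)" using kG q by (simp add: m_assoc)
    qed
    show ?thesis
    proof (cases "\<phi> q v = v")
      case True
      then have "q \<in> K" using q Kv by blast
      then show ?thesis using above[of \<one>] True v_notin q by (intro bexI[of _ \<one>]) (auto simp: KK_def)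
    next
      case False
      then obtain w where w: "Adj v w" "\<phi> q v \<in> B v w" using direction_exists[OF v act_closed[OF q(1) v]] by blast
      note wV = adj_V(2)[OF w(1)]
      define e where "e = (\<phi> (inv q) v, \<phi> (inv q) w)"
      have "\<phi> q' v \<notin> B v w" using change w by blast
      then have e: "e \<in> C" using crossings_mem[OF D(2) q(1,2,4) w(1)] w(2) unfolding C_def e_def by blast
      define k where "k = \<kappa> e"
      have k: "k \<in> KK" "k \<in> carrier G" using e \<kappa>(1) by (auto simp: k_def KK_def)
      have kv: "\<phi> k (\<phi> (inv q) v) = v" "\<phi> k (\<phi> (inv q) w) = \<rho> w"
        using \<kappa>(2,3)[OF q(1) wV] by (simp_all add: k_def e_def)
      have "\<phi> (inv k) v = \<phi> (inv q) v" "\<phi> (inv k) (\<rho> w) = \<phi> (inv q) w"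
        using act_inv1[OF k(2), of "\<phi> (inv q) v"] act_inv1[OF k(2), of "\<phi> (inv q) w"] kv act_closed[of "inv q"] q v wV
        by simp_all
      then have x: "\<phi> (q \<otimes> inv k) v = v" "\<phi> (q \<otimes> inv k) (\<rho> w) = w"
        using act_mult[of q "inv k"] act_inv2[OF q(1)] q k v wV \<rho>(3)[OF wV] by simp_all
      then have xK: "q \<otimes> inv k \<in> K" using q k by (simp add: Kv)
      then have "q \<otimes> inv k \<in> Z w" using x above[OF k(1)] by (simp add: Z_def)
      moreover have "\<rho> w \<in> W" using w(1) q(1) e unfolding W_def e_def by blast
      ultimately show ?thesis using xK above[OF k(1)] k(1) False unique[OF w(1) _ w(2)] by blast
    qed
  qed
  define Rch where "Rch y \<longleftrightarrow> (\<exists>x\<in>g1 <# H. x \<in> A \<and> (x, y) \<in> R)" for y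
  have Rch_R: "Rch y \<Longrightarrow> (y, z) \<in> R \<Longrightarrow> Rch z" for y z
    unfolding Rch_def R_def by (meson rtrancl_trans)
  \<comment> \<open>The invariant carried along the path. Inside a branch all of \<open>Z w\<close>
    has to be reachable, since the path may leave the branch far from where it entered;
    \<open>Zconn\<close> makes this possible.\<close>
  define J where "J q \<longleftrightarrow> (\<phi> q v = v \<longrightarrow> Rch (q \<otimes> c)) \<and>
    (\<forall>w. Adj v w \<longrightarrow> \<phi> q v \<in> B v w \<longrightarrow> (\<forall>x\<in>Z w. Rch (x \<otimes> c)))" for q
  have "J q'" if q: "(q, q') \<in> (step_rel G D (upset d))\<^sup>*" "\<phi> q v \<in> B v w1" for q q'
    using q(1)
  proof (induction rule: rtrancl_induct)
    case base
    have "Rch (x \<otimes> c)" if x: "x \<in> Z w1" for x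
    proof -
      have "\<rho> w1 = w0" using \<rho>(1) \<rho>(2)[OF w0V g(1)] by (simp add: w1_def)
      then have xK: "x \<in> K" "\<phi> x w0 = w1" "x \<otimes> c \<in> A" using x Ac_iff by (auto simp: Z_def)
      have "inv g1 \<otimes> x \<in> K" using Kmult[OF Kinv] g(1) xK(1) by blast
      moreover have "\<phi> (inv g1 \<otimes> x) w0 = w0"
        using xK(2) act_mult[of "inv g1" x w0] act_inv1[of g1 w0] KG[OF g(1)] KG[OF xK(1)] w0V by (simp add: w1_def)
      \<comment> \<open>That \<open>c\<close> lies in \<open>H\<close> is used here: multiplication
        by it does not leave the coset \<open>g1 <# H\<close>.\<close>
      ultimately have "inv g1 \<otimes> x \<in> H" by (simp add: H_def E_iff)
      then have "inv g1 \<otimes> x \<otimes> c \<in> H" using subgroup.m_closed[OF E[OF w0]] c(1) unfolding H_def by blast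
      moreover have "x \<otimes> c = g1 \<otimes> (inv g1 \<otimes> x \<otimes> c)" using KG g xK cG by (simp add: m_assoc cancel_inv)
      ultimately have "x \<otimes> c \<in> g1 <# H" unfolding l_coset_def by blast
      then show ?thesis using xK unfolding Rch_def R_def by blast
    qed
    then show ?case using unique[OF adj12(1) _ q(2)] v_notin[OF adj12(1)] q(2) unfolding J_def by metis
  next
    case (step y z)
    note yz = step_rel_diff[OF step(2) upset_carrier]
    have G: "y \<in> carrier G" "z \<in> carrier G" "d \<sqsubseteq> y" "d \<sqsubseteq> z" using yz by (auto simp: upset_def)
    show ?case
    \<comment> \<open>Within one branch the invariant says the same at both points. Only a change of
      branch, or a visit to \<open>v\<close>, is copied to the vertex group as a step.\<close>
    proof (cases "\<exists>w. Adj v w \<and> \<phi> y v \<in> B v w \<and> \<phi> z v \<in> B v w")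
      case True
      then obtain w where w: "Adj v w" "\<phi> y v \<in> B v w" "\<phi> z v \<in> B v w" by blast
      then show ?thesis using step.IH unique[OF w(1) _ w(3)] v_notin[OF w(1)] unfolding J_def by metis
    next
      case False
      obtain k where k: "k \<in> KK" "y \<otimes> inv k \<in> K" "d \<sqsubseteq> y \<otimes> inv k \<otimes> (c \<otimes> d)" "\<phi> y v = v \<longrightarrow> y \<otimes> inv k = y"
        "\<forall>w. Adj v w \<longrightarrow> \<phi> y v \<in> B v w \<longrightarrow> y \<otimes> inv k \<in> Z w \<and> \<rho> w \<in> W"
        using anchor[OF G(1,2,3) yz(3) False] by blast
      obtain l where l: "l \<in> KK" "z \<otimes> inv l \<in> K" "d \<sqsubseteq> z \<otimes> inv l \<otimes> (c \<otimes> d)" "\<phi> z v = v \<longrightarrow> z \<otimes> inv l = z"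
        "\<forall>w. Adj v w \<longrightarrow> \<phi> z v \<in> B v w \<longrightarrow> z \<otimes> inv l \<in> Z w \<and> \<rho> w \<in> W"
        using anchor[OF G(2,1,4) yz(4)] False by blast
      have klG: "k \<in> carrier G" "l \<in> carrier G" using k(1) l(1) KK by auto
      have "Rch (y \<otimes> inv k \<otimes> c)"
      proof (cases "\<phi> y v = v")
        case True
        then show ?thesis using step.IH k(4) by (simp add: J_def)
      next
        case False
        then obtain w where "Adj v w" "\<phi> y v \<in> B v w" using direction_exists[OF v act_closed[OF G(1) v]] by blast
        then show ?thesis using step.IH k(5) unfolding J_def by blast
      qed
      moreover have "(y \<otimes> inv k \<otimes> c, z \<otimes> inv l \<otimes> c) \<in> R"
      proof -
        have "inv (y \<otimes> inv k \<otimes> c) \<otimes> (z \<otimes> inv l \<otimes> c) = inv c \<otimes> (k \<otimes> (inv y \<otimes> z) \<otimes> inv l) \<otimes> c"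
          using G klG cG by (simp add: inv_mult_group m_assoc)
        moreover have "inv (y \<otimes> inv k \<otimes> c) \<otimes> (z \<otimes> inv l \<otimes> c) \<in> K"
          using k(2) l(2) cK Kmult Kinv by blast
        ultimately have "inv (y \<otimes> inv k \<otimes> c) \<otimes> (z \<otimes> inv l \<otimes> c) \<in> DR"
          using k(1) l(1) yz(3) unfolding DR_def by (intro UnI2 IntI image_eqI[of _ _ "(k, inv y \<otimes> z, l)"]) auto
        then show ?thesis
          using Ac_iff[OF k(2)] Ac_iff[OF l(2)] k(3) l(3) unfolding R_def
          by (intro r_into_rtrancl) (simp add: step_rel_def)
      qed
      ultimately have zl: "Rch (z \<otimes> inv l \<otimes> c)" by (rule Rch_R)
      show ?thesis unfolding J_def
      proof (intro conjI impI allI ballI)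
        assume "\<phi> z v = v"
        then show "Rch (z \<otimes> c)" using zl l(4) by simp
      next
        fix w x assume w: "Adj v w" "\<phi> z v \<in> B v w" and x: "x \<in> Z w"
        then show "Rch (x \<otimes> c)" using Rch_R[OF zl Zconn[OF _ x w(1)]] l(5) by blast
      qed
    qed
  qed
  moreover have "\<not> J q" if q: "\<phi> q v \<in> B v w2" for q
  proof
    assume J: "J q"
    have g2G: "g2 \<in> carrier G" using KG g by blast
    \<comment> \<open>Cofinality shows that \<open>Z w2\<close> is not empty:
      \<open>g2 \<otimes> h \<otimes> d\<close> is above \<open>d\<close>, and the factor
      \<open>inv c\<close> in \<open>x\<close> is chosen so that \<open>x \<otimes> c\<close> is
      \<open>g2 \<otimes> h\<close>, a point of the forbidden coset.\<close>
    obtain h where h: "h \<in> H" "inv g2 \<otimes> d \<sqsubseteq> h \<otimes> d" using cofinal[of "inv g2 \<otimes> d"] g2G d by (auto simp: H_def E_def)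
    have hK: "h \<in> K" "\<phi> h w0 = w0" using h(1) by (simp_all add: H_def E_iff)
    note hG = KG[OF hK(1)]
    have "d \<sqsubseteq> g2 \<otimes> (h \<otimes> d)"
      using le_mult[of g2 "inv g2 \<otimes> d" "h \<otimes> d"] h(2) g2G d hG by (simp add: cancel_inv)
    moreover define x where "x = g2 \<otimes> h \<otimes> inv c"
    have cw: "\<phi> (inv c) w0 = w0"
      using act_inv1[OF cG w0V] c(1) by (simp add: H_def E_iff)
    have xK: "x \<in> K" using g hK cK Kmult Kinv by (simp add: x_def)
    have xc: "x \<otimes> c = g2 \<otimes> h" using g2G hG cG by (simp add: x_def m_assoc)
    have "\<phi> x w0 = w2"
      using act_mult[of "g2 \<otimes> h" "inv c" w0] act_mult[of g2 h w0] g2G hG cG w0V cw hK(2) by (simp add: x_def w2_def)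
    moreover have "\<rho> w2 = w0" using \<rho>(1) \<rho>(2)[OF w0V g(2)] by (simp add: w2_def)
    moreover have "x \<otimes> (c \<otimes> d) = g2 \<otimes> (h \<otimes> d)"
      using xc g2G hG cG d KG[OF xK] by (simp flip: m_assoc)
    ultimately have "x \<in> Z w2" using xK by (simp add: Z_def)
    then have "Rch (x \<otimes> c)" using J adj12(2) q unfolding J_def by blast
    moreover have "x \<otimes> c \<in> g2 <# H" unfolding xc l_coset_def using h(1) by blast
    ultimately show False using apart unfolding Rch_def by blast
  qed
  ultimately have "separated D d (B v w1) (B v w2)" unfolding separated_def by blast
  then show ?thesis using adj12 by blast
qed

text \<open>Either some \<open>h \<otimes> d\<close> with \<open>h\<close> in the edge group \<open>H\<close> exceeds any given element, and swamps of the vertex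
  group apply, or all sets \<open>H \<otimes> k\<close> are bounded and a translate of \<open>H\<close> itself is a swamp.\<close>

lemma separated_halftrees:
  assumes w0: "Adj v w0" and D: "finite D" "D \<subseteq> carrier G"
    and Hucha: "Hucha (G\<lparr>carrier := vstab G \<phi> v\<rparr>) {vstab G \<phi> v \<inter> vstab G \<phi> w0}"
    and Prieto: "\<And>w. Adj v w \<Longrightarrow> Prieto (G\<lparr>carrier := vstab G \<phi> v \<inter> vstab G \<phi> w\<rparr>)"
  shows "\<exists>d a b a' b'. d \<in> carrier G \<and> Adj a b \<and> Adj a' b' \<and> separated D d (B a b) (B a' b')"
proof (cases "\<exists>d\<in>carrier G. \<forall>m\<in>carrier G. \<exists>h\<in>vstab G \<phi> v \<inter> vstab G \<phi> w0. m \<sqsubseteq> h \<otimes> d")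
  case True
  then obtain d where d: "d \<in> carrier G"
    "\<And>m. m \<in> carrier G \<Longrightarrow> \<exists>h\<in>vstab G \<phi> v \<inter> vstab G \<phi> w0. m \<sqsubseteq> h \<otimes> d" by blast
  show ?thesis using separated_cofinal[OF w0 D d Hucha Prieto] d(1) by blast
next
  case False
  have "\<exists>m\<in>carrier G. \<forall>h\<in>vstab G \<phi> v \<inter> vstab G \<phi> w0. h \<otimes> k \<sqsubseteq> m" if k: "k \<in> carrier G" for k
  proof -
    obtain m where m: "m \<in> carrier G" "\<And>h. h \<in> vstab G \<phi> v \<inter> vstab G \<phi> w0 \<Longrightarrow> \<not> m \<sqsubseteq> h \<otimes> k"
      using False k by blast
    have "h \<otimes> k \<sqsubseteq> m" if h: "h \<in> vstab G \<phi> v \<inter> vstab G \<phi> w0" for h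
      using le_total[OF m(1), of "h \<otimes> k"] m(2)[OF h] h k by (auto simp: vstab_def)
    then show ?thesis using m(1) by blast
  qed
  then obtain d where "d \<in> carrier G" "separated D d (B w0 v) (B v w0)"
    using separated_bounded[OF w0 D] by blast
  then show ?thesis using w0 adj_V(3)[OF w0] by blast
qed

section \<open>Assembly of the negative swamp\<close>

lemma step_rel_translate:
  assumes d: "d \<in> carrier G" and q: "(q, q') \<in> (step_rel G D (insert \<one> P))\<^sup>*"
  shows "(d \<otimes> q, d \<otimes> q') \<in> (step_rel G D (upset d))\<^sup>*"
  using q
proof (induction rule: rtrancl_induct)
  case (step y z)
  have yz: "y \<in> insert \<one> P" "z \<in> insert \<one> P" using step(2) by (auto simp: step_rel_def)
  have up: "d \<otimes> x \<in> upset d \<and> x \<in> carrier G" if "x \<in> insert \<one> P" for x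
    using that d P_closed by (auto simp: upset_def le_def cancel_inv)
  have "inv (d \<otimes> s) \<otimes> (d \<otimes> t) = inv s \<otimes> t" if "s \<in> carrier G" "t \<in> carrier G" for s t
    using that d by (simp add: inv_mult_group m_assoc cancel_inv)
  then have "(d \<otimes> y, d \<otimes> z) \<in> step_rel G D (upset d)"
    using step(2) up[OF yz(1)] up[OF yz(2)] by (simp add: step_rel_def)
  then show ?case using step.IH by (rule rtrancl_into_rtrancl[rotated])
qed simp

text \<open>Left translation by \<open>d\<close> carries a path without negative elements to a path
  above \<open>d\<close>. The two positive elements and the two cosets are therefore
  \<open>inv d\<close>-translates of elements located in the separated half-trees.\<close>

lemma negative_swamp_exists:
  assumes Sg: "gen_set G Sg" and w0: "Adj v w0"
    and Hucha: "Hucha (G\<lparr>carrier := vstab G \<phi> v\<rparr>) {vstab G \<phi> v \<inter> vstab G \<phi> w0}"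
    and Prieto: "\<And>w. Adj v w \<Longrightarrow> Prieto (G\<lparr>carrier := vstab G \<phi> v \<inter> vstab G \<phi> w\<rparr>)"
    and L: "(\<exists>g\<in>carrier G. L = generate G {g}) \<or> (subgroup L G \<and> acts_elliptically G V \<phi> L)"
  shows "negative_swamp G Sg P L r (m_inv G ` P)"
proof -
  define D where "D = {g \<in> carrier G. real (word_len G Sg g) \<le> r}"
  have D: "finite D" "D \<subseteq> carrier G" using finite_word_ball[OF Sg] by (auto simp: D_def)
  obtain d a b a' b' where d: "d \<in> carrier G" and ab: "Adj a b" and ab': "Adj a' b'"
    and sep: "separated D d (B a b) (B a' b')"
    using separated_halftrees[OF w0 D Hucha Prieto] by blast
  have disconnect: "set ps \<inter> m_inv G ` P \<noteq> {}"
    if ps: "r_path G Sg r ps" "\<phi> (d \<otimes> hd ps) v \<in> B a b" "\<phi> (d \<otimes> last ps) v \<in> B a' b'" for ps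
  proof
    assume "set ps \<inter> m_inv G ` P = {}"
    moreover have "set ps \<subseteq> carrier G" "ps \<noteq> []" using ps(1) by (auto simp: r_path_def)
    ultimately have pos: "set ps \<subseteq> insert \<one> P" "hd ps \<in> insert \<one> P"
      using negative_iff[OF group_axioms cone] hd_in_set[of ps] by blast+
    then have "(d \<otimes> hd ps, d \<otimes> last ps) \<in> (step_rel G D (upset d))\<^sup>*"
      using step_rel_translate[OF d r_path_step_rel[OF ps(1) pos(1)]] by (simp add: D_def)
    moreover have "d \<otimes> hd ps \<in> upset d"
      using pos(2) d P_closed by (auto simp: upset_def le_def cancel_inv)
    ultimately show False using sep ps(2,3) unfolding separated_def by blast
  qed
  obtain s where s: "s \<in> carrier G" "\<phi> s v \<in> B a b" "inv d \<otimes> s \<in> P" using halftree_unbounded[OF ab d] by blast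
  obtain t where t: "t \<in> carrier G" "\<phi> t v \<in> B a' b'" "inv d \<otimes> t \<in> P" using halftree_unbounded[OF ab' d] by blast
  obtain f where f: "f \<in> carrier G" "\<forall>h\<in>L. \<phi> (f \<otimes> h) v \<in> B a b" using coset_into_halftree[OF v ab L] by blast
  obtain g where g: "g \<in> carrier G" "\<forall>h\<in>L. \<phi> (g \<otimes> h) v \<in> B a' b'" using coset_into_halftree[OF v ab' L] by blast
  have LG: "L \<subseteq> carrier G"
    using L by (metis generate_incl empty_subsetI insert_subset subgroup.subset)
  have coset: "\<phi> (d \<otimes> x) v \<in> Y"
    if x: "x \<in> (inv d \<otimes> e) <# L" "e \<in> carrier G" "\<forall>h\<in>L. \<phi> (e \<otimes> h) v \<in> Y" for x e Y
  proof -
    obtain h where h: "h \<in> L" "x = inv d \<otimes> e \<otimes> h" using x(1) by (auto simp: l_coset_def)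
    then have "d \<otimes> x = e \<otimes> h" using LG x(2) d by (auto simp: m_assoc cancel_inv)
    then show ?thesis using x(3) h(1) by simp
  qed
  have "r_disconnects_set G Sg r (m_inv G ` P) P"
    unfolding r_disconnects_set_def
  proof (intro bexI)
    show "r_disconnects G Sg r (m_inv G ` P) {inv d \<otimes> s} {inv d \<otimes> t}"
      unfolding r_disconnects_def using disconnect s t d cancel_inv(2) by auto
  qed (use s t in auto)
  moreover have "r_disconnects G Sg r (m_inv G ` P) ((inv d \<otimes> f) <# L) ((inv d \<otimes> g) <# L)"
    unfolding r_disconnects_def using disconnect coset f g by blast
  ultimately show ?thesis unfolding negative_swamp_def using d f g by blast
qed

end

theorem theorem5p12:
  fixes G :: "('g, 'b) monoid_scheme"
    and V :: "'v set" and Adj :: "'v \<Rightarrow> 'v \<Rightarrow> bool" and \<phi> :: "'g \<Rightarrow> 'v \<Rightarrow> 'v"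
    and v :: 'v and H :: "'g set"
  assumes "tree_action G V Adj \<phi>"
    and "without_inversions G Adj \<phi>"
    and "fin_gen G" and "left_orderable G"
    and "cofinite_action G V Adj \<phi>"
    and "minimal_action G V Adj \<phi>"
    and "general_type G V Adj \<phi>"
    and "\<forall>x\<in>V. fin_gen (G\<lparr>carrier := vstab G \<phi> x\<rparr>)"
    and "v \<in> V"
    and "H \<in> {estab G \<phi> e | e. e \<in> link Adj v}"
    and "Hucha (G\<lparr>carrier := vstab G \<phi> v\<rparr>) {H}"
    and "\<forall>e\<in>link Adj v. Prieto (G\<lparr>carrier := estab G \<phi> e\<rparr>)"
  shows "Hucha G ({generate G {g} | g. g \<in> carrier G} \<union>
                  {L. subgroup L G \<and> acts_elliptically G V \<phi> L})"
proof -
  interpret group_action G V \<phi> using assms(1) by (simp add: tree_action_def)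
  interpret group G using assms(1) by (simp add: tree_action_def)
  interpret general_tree_action G V Adj \<phi>
    using assms(1,2,6,7) by unfold_locales (auto simp: tree_action_def)
  have link_iff: "{v, w} \<in> link Adj v" if "Adj v w" for w
    using that by (auto simp: link_def edges_def)
  obtain e where e: "e \<in> link Adj v" "H = estab G \<phi> e" using assms(10) by blast
  then obtain x y where "e = {x, y}" "Adj x y" "v \<in> {x, y}" by (auto simp: link_def edges_def)
  then obtain w0 where w0: "Adj v w0" "e = {v, w0}" using adj_V(3) by (metis insert_commute insert_iff singletonD)
  have Hucha: "Hucha (G\<lparr>carrier := vstab G \<phi> v\<rparr>) {vstab G \<phi> v \<inter> vstab G \<phi> w0}"
    using assms(11) e(2) estab_edge[OF w0(1)] w0(2) by simp
  have Prieto: "Prieto (G\<lparr>carrier := vstab G \<phi> v \<inter> vstab G \<phi> w\<rparr>)" if "Adj v w" for w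
    using assms(12) link_iff[OF that] estab_edge[OF that] by fastforce
  \<comment> \<open>A single generating set is fixed before the cone, the subgroup and the width, in
    the order of quantifiers of \<open>Hucha\<close>.\<close>
  obtain Sg where Sg: "gen_set G Sg" using assms(3) by (auto simp: fin_gen_def gen_set_def)
  have "negative_swamp G Sg P L r (m_inv G ` P)"
    if P: "positive_cone G P" and L: "L \<in> {generate G {g} | g. g \<in> carrier G} \<union>
      {L. subgroup L G \<and> acts_elliptically G V \<phi> L}" for P L r
  proof -
    interpret ordered_tree_action G V Adj \<phi> P v
      using P assms(9) by unfold_locales
    show ?thesis using negative_swamp_exists[OF Sg w0(1) Hucha Prieto] L by blast
  qed
  then show ?thesis unfolding Hucha_def using assms(3,4) Sg by blast
qed

end
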